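(* Let $\mathcal{C}$ be a finitely complete category with a weak factorization system $(\mathfrak{L},\mathfrak{R})$ and a functorial choice $(-)^I$ of path objects in $\mathcal{C}$ and in all of its slices, which is stable under substitution, i.e., given any fibration $B\to A$ and any arrow $\sigma:A'\to A$, $$\sigma^*\bigl(B^I\bigr)\cong\bigl(\sigma^*B\bigr)^I .$$ Then $\mathcal{C}$ is a model of the form of Martin-Löf type theory with identity types whose rules are the structural rules, the formation, introduction, elimination and conversion rules for identity types, and the Beck-Chevalley rules for identity types and reflexivity terms. In this model types are interpreted as fibrations and the identity type of $A$ is interpreted as the path object of $A$.
   Context: **Weak factorization systems.** For maps $f:A\to B$ and $g:C\to D$, write $f\pitchfork g$ if for all $h:A\to C$ and $k:B\to D$ with $g\circ h=k\circ f$ there is $l:B\to C$ with $g\circ l=k$ and $l\circ f=h$. For a collection $\mathfrak{M}$ of maps, ${}^{\pitchfork}\mathfrak{M}$ is the collection of maps $f$ with $f\pitchfork m$ for all $m\in\mathfrak{M}$, and $\mathfrak{M}^{\pitchfork}$ is the collection of maps $g$ with $m\pitchfork g$ for all $m\in\mathfrak{M}$. A weak factorization system $(\mathfrak{L},\mathfrak{R})$ on $\mathcal{C}$ consists of two collections of maps such that every map factors as $p\circ i$ with $i\in\mathfrak{L}$ and $p\in\mathfrak{R}$, and $\mathfrak{L}^{\pitchfork}=\mathfrak{R}$, $\mathfrak{L}={}^{\pitchfork}\mathfrak{R}$. Maps in $\mathfrak{R}$ are called fibrations and maps in $\mathfrak{L}$ acyclic cofibrations. An object $A$ is fibrant if $A\to1$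 is a fibration. Each slice $\mathcal{C}/\Gamma$ carries the induced weak factorization system (a map is in the left or right class iff its underlying map in $\mathcal{C}$ is). The fibrant objects of $\mathcal{C}/\Gamma$ are the fibrations $B\to\Gamma$. **Path objects.** A path object for a fibrant object $B\to\Gamma$ of $\mathcal{C}/\Gamma$ is a factorization $B\xrightarrow{\,r\,}B^I\xrightarrow{\,p\,}B\times_\Gamma B$ over $\Gamma$ of the diagonal $\Delta$, with $r\in\mathfrak{L}$ and $p\in\mathfrak{R}$. A functorial choice of path objects in $\mathcal{C}$ and its slices assigns, for each $\Gamma$ (including $\Gamma=1$), such a factorization to each fibrant object of $\mathcal{C}/\Gamma$, functorially in the object and with $r,p$ natural. The stability isomorphism $\sigma^*(B^I)\cong(\sigma^*B)^I$ is an isomorphism over $A'$ of factorizations of the diagonal, i.e. compatible with the maps $r$ and $p$ (under $\sigma^*(B\times_AB)\cong\sigma^*B\times_{A'}\sigma^*B$). Here $B^I$ is formed in $\mathcal{C}/A$ and $(\sigma^*B)^I$ in $\mathcal{C}/A'$. **The type theory.** Besides the usual structural rules of dependent type theory, the rules are the following, each in an arbitrary ambient context: - Formation: from $a:A$ and $b:A$ infer $\mathrm{Id}_A(a,b):\mathrm{type}$. - Introduction: from $a:A$ infer $r_A(a):\mathrm{Id}_A(a,a)$. - Elimination: from $x:A,y:A,z:\mathrm{Id}_A(x,y)\vdash D(x,y,z):\mathrm{type}$, $\ p:\mathrm{Id}_A(a,b)$ and $x:A\vdash d(x):D(x,x,r_A(x))$ infer $J_{A,D}(d,a,b,p):D(a,b,p)$.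 - Conversion: from $x:A,y:A,z:\mathrm{Id}_A(x,y)\vdash D(x,y,z):\mathrm{type}$, $\ a:A$ and $x:A\vdash d(x):D(x,x,r_A(x))$ infer $J_{A,D}(d,a,a,r_A(a))=d(a):D(a,a,r_A(a))$. - Beck-Chevalley for $\mathrm{Id}$: from $x:C\vdash A(x):\mathrm{type}$, $x:C\vdash a(x),b(x):A(x)$ and $c:C$ infer $\bigl(\mathrm{Id}_{A(x)}(a(x),b(x))\bigr)[c/x]=\mathrm{Id}_{A(c)}(a(c),b(c)):\mathrm{type}$. - Beck-Chevalley for $r$: from $x:C\vdash A(x):\mathrm{type}$, $x:C\vdash a(x):A(x)$ and $c:C$ infer $\bigl(r_{A(x)}(a(x))\bigr)[c/x]=r_{A(c)}(a(c)):\mathrm{Id}_{A(c)}(a(c),a(c))$. No Beck-Chevalley (substitution) rule for $J$-terms is part of the theory, and neither are dependent products. **Interpretation.** A judgement $\vdash A:\mathrm{type}$ is interpreted as a fibrant object. Contexts are interpreted as chains of fibrations $A_n\to\cdots\to A_0\to1$ (write $\Gamma$ for $A_n$; the empty context is $1$). A judgement $\Gamma\vdash A:\mathrm{type}$ is interpreted as a fibration $A\to\Gamma$, and $\Gamma\vdash a:A$ as a section of $A\to\Gamma$. Substitution is interpreted by pullback, and definitional equality as identity. Substitution is modelled only up to canonical isomorphism, and isomorphic objects are conflated, so equations arising from substitution are read modulo the canonical and stability isomorphisms. For a type $A\to\Gamma$, the judgement $\Gamma,x,y:A\vdash\mathrm{Id}_A(x,y)$ is interpreted as $p:A^I\to A\times_\Gamma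 A$ and $\mathrm{Id}_A(a,b)$ as its pullback along $(a,b):\Gamma\to A\times_\Gamma A$. The term $r_A(a)$ is the section of $\mathrm{Id}_A(a,a)$ induced by $r\circ a$. "$\mathcal{C}$ is a model" means that all the rules are valid in this interpretation. The elimination and conversion rules are equivalent to their versions with $a,b,p$ replaced by variables $x,y,z$ in the context. Their validity amounts to: for every type $A\to\Gamma$ in context, every fibration $g:D\to A^I$ and every $d:A\to D$ with $g\circ d=r$, there is an arrow $J:A^I\to D$ (a choice of which interprets $J_{A,D}(d,x,y,z)$) with $g\circ J=1_{A^I}$ (elimination) and $J\circ r=d$ (conversion). *)

theory Defs
  imports Main
begin

section \<open>Categories, functors, finite limits\<close>

record ('o, 'a) cat =
  Ob :: "'o set"
  Ar :: "'a set"
  Dom :: "'a \<Rightarrow> 'o"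
  Cod :: "'a \<Rightarrow> 'o"
  Idt :: "'o \<Rightarrow> 'a"
  Comp :: "'a \<Rightarrow> 'a \<Rightarrow> 'a"  (infixr "\<odot>\<index>" 70)

definition hom :: "('o, 'a) cat \<Rightarrow> 'o \<Rightarrow> 'o \<Rightarrow> 'a set" where
  "hom C A B = {f \<in> Ar C. Dom C f = A \<and> Cod C f = B}"

locale category =
  fixes C :: "('o, 'a) cat" (structure)
  assumes Dom_Ob: "f \<in> Ar C \<Longrightarrow> Dom C f \<in> Ob C"
    and Cod_Ob: "f \<in> Ar C \<Longrightarrow> Cod C f \<in> Ob C"
    and Idt_hom: "A \<in> Ob C \<Longrightarrow> Idt C A \<in> hom C A A"
    and Comp_hom: "\<lbrakk>f \<in> hom C A B; g \<in> hom C B D\<rbrakk> \<Longrightarrow> g \<odot> f \<in> hom C A D"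
    and Comp_Idt: "f \<in> hom C A B \<Longrightarrow> f \<odot> Idt C A = f"
    and Idt_Comp: "f \<in> hom C A B \<Longrightarrow> Idt C B \<odot> f = f"
    and Comp_assoc: "\<lbrakk>f \<in> hom C A B; g \<in> hom C B D; h \<in> hom C D E\<rbrakk>
      \<Longrightarrow> h \<odot> (g \<odot> f) = (h \<odot> g) \<odot> f"

definition iso :: "('o, 'a) cat \<Rightarrow> 'a \<Rightarrow> bool" where
  "iso C f \<longleftrightarrow> f \<in> Ar C \<and>
     (\<exists>g \<in> hom C (Cod C f) (Dom C f).
        Comp C g f = Idt C (Dom C f) \<and> Comp C f g = Idt C (Cod C f))"

definition is_functor ::
  "('i, 'j) cat \<Rightarrow> ('o, 'a) cat \<Rightarrow> ('i \<Rightarrow> 'o) \<Rightarrow> ('j \<Rightarrow> 'a) \<Rightarrow> bool" where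
  "is_functor S C Fo Fa \<longleftrightarrow>
     (\<forall>j \<in> Ob S. Fo j \<in> Ob C) \<and>
     (\<forall>u \<in> Ar S. Fa u \<in> hom C (Fo (Dom S u)) (Fo (Cod S u))) \<and>
     (\<forall>j \<in> Ob S. Fa (Idt S j) = Idt C (Fo j)) \<and>
     (\<forall>u \<in> Ar S. \<forall>v \<in> Ar S. Cod S u = Dom S v \<longrightarrow>
        Fa (Comp S v u) = Comp C (Fa v) (Fa u))"

definition nat_trans ::
  "('i, 'j) cat \<Rightarrow> ('o, 'a) cat \<Rightarrow> ('i \<Rightarrow> 'o) \<Rightarrow> ('j \<Rightarrow> 'a) \<Rightarrow> ('i \<Rightarrow> 'o) \<Rightarrow> ('j \<Rightarrow> 'a)
     \<Rightarrow> ('i \<Rightarrow> 'a) \<Rightarrow> bool" where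
  "nat_trans S C Fo Fa Go Ga \<eta> \<longleftrightarrow>
     (\<forall>j \<in> Ob S. \<eta> j \<in> hom C (Fo j) (Go j)) \<and>
     (\<forall>u \<in> Ar S. Comp C (\<eta> (Cod S u)) (Fa u) = Comp C (Ga u) (\<eta> (Dom S u)))"

definition is_cone ::
  "('i, 'j) cat \<Rightarrow> ('o, 'a) cat \<Rightarrow> ('i \<Rightarrow> 'o) \<Rightarrow> ('j \<Rightarrow> 'a) \<Rightarrow> 'o \<Rightarrow> ('i \<Rightarrow> 'a) \<Rightarrow> bool" where
  "is_cone S C Fo Fa X \<mu> \<longleftrightarrow> X \<in> Ob C \<and>
     (\<forall>j \<in> Ob S. \<mu> j \<in> hom C X (Fo j)) \<and>
     (\<forall>u \<in> Ar S. Comp C (Fa u) (\<mu> (Dom S u)) = \<mu> (Cod S u))"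

definition is_limit ::
  "('i, 'j) cat \<Rightarrow> ('o, 'a) cat \<Rightarrow> ('i \<Rightarrow> 'o) \<Rightarrow> ('j \<Rightarrow> 'a) \<Rightarrow> 'o \<Rightarrow> ('i \<Rightarrow> 'a) \<Rightarrow> bool" where
  "is_limit S C Fo Fa Lim \<pi> \<longleftrightarrow> is_cone S C Fo Fa Lim \<pi> \<and>
     (\<forall>X \<mu>. is_cone S C Fo Fa X \<mu> \<longrightarrow>
        (\<exists>!h. h \<in> hom C X Lim \<and> (\<forall>j \<in> Ob S. Comp C (\<pi> j) h = \<mu> j)))"

text \<open>Every finite category is isomorphic to one whose objects and arrows are natural numbers.\<close>

definition finitely_complete :: "('o, 'a) cat \<Rightarrow> bool" where
  "finitely_complete C \<longleftrightarrow>
     (\<forall>(S :: (nat, nat) cat) Fo Fa.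
        category S \<and> finite (Ob S) \<and> finite (Ar S) \<and> is_functor S C Fo Fa \<longrightarrow>
        (\<exists>Lim \<pi>. is_limit S C Fo Fa Lim \<pi>))"

text \<open>The slice over \<open>X\<close>: an object is an arrow \<open>f\<close> into \<open>X\<close>, an arrow \<open>(f, h, g)\<close> from
  \<open>f\<close> to \<open>g\<close> is an arrow \<open>h\<close> of \<open>C\<close> with \<open>g \<odot> h = f\<close>, tagged with its ends.\<close>

definition slice :: "('o, 'a) cat \<Rightarrow> 'o \<Rightarrow> ('a, 'a \<times> 'a \<times> 'a) cat" where
  "slice C X = \<lparr>
     Ob = {f \<in> Ar C. Cod C f = X},
     Ar = {(f, h, g). f \<in> Ar C \<and> Cod C f = X \<and> g \<in> Ar C \<and> Cod C g = X \<and>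
            h \<in> hom C (Dom C f) (Dom C g) \<and> Comp C g h = f},
     Dom = (\<lambda>(f, h, g). f),
     Cod = (\<lambda>(f, h, g). g),
     Idt = (\<lambda>f. (f, Idt C (Dom C f), f)),
     Comp = (\<lambda>(g', k, e) (f, h, g). (f, Comp C k h, e))\<rparr>"

definition full_sub :: "('o, 'a) cat \<Rightarrow> 'o set \<Rightarrow> ('o, 'a) cat" where
  "full_sub C S = C\<lparr>Ob := Ob C \<inter> S, Ar := {f \<in> Ar C. Dom C f \<in> S \<and> Cod C f \<in> S}\<rparr>"


section \<open>Weak factorization systems\<close>

context
  fixes C :: "('o, 'a) cat" (structure)
begin

definition lifts :: "'a \<Rightarrow> 'a \<Rightarrow> bool" where
  "lifts f g \<longleftrightarrow>
     (\<forall>h \<in> hom C (Dom C f) (Dom C g). \<forall>k \<in> hom C (Cod C f) (Cod C g).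
        g \<odot> h = k \<odot> f \<longrightarrow> (\<exists>l \<in> hom C (Cod C f) (Dom C g). g \<odot> l = k \<and> l \<odot> f = h))"

definition weak_factorization_system :: "'a set \<Rightarrow> 'a set \<Rightarrow> bool" where
  "weak_factorization_system L R \<longleftrightarrow> L \<subseteq> Ar C \<and> R \<subseteq> Ar C \<and>
     (\<forall>f \<in> Ar C. \<exists>i \<in> L. \<exists>p \<in> R. Dom C i = Dom C f \<and> Cod C i = Dom C p \<and>
        Cod C p = Cod C f \<and> f = p \<odot> i) \<and>
     {g \<in> Ar C. \<forall>m \<in> L. lifts m g} = R \<and>
     L = {f \<in> Ar C. \<forall>m \<in> R. lifts f m}"


section \<open>Terminal object and pullbacks\<close>

definition terminal :: "'o \<Rightarrow> bool" where
  "terminal T \<longleftrightarrow> T \<in> Ob C \<and> (\<forall>X \<in> Ob C. \<exists>!h. h \<in> hom C X T)"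

definition is_pullback :: "'a \<Rightarrow> 'a \<Rightarrow> 'a \<Rightarrow> 'a \<Rightarrow> bool" where
  "is_pullback s f u v \<longleftrightarrow> s \<in> Ar C \<and> f \<in> Ar C \<and> Cod C s = Cod C f \<and>
     u \<in> hom C (Dom C v) (Dom C s) \<and> v \<in> hom C (Dom C u) (Dom C f) \<and> s \<odot> u = f \<odot> v \<and>
     (\<forall>X. \<forall>h \<in> hom C X (Dom C s). \<forall>k \<in> hom C X (Dom C f). s \<odot> h = f \<odot> k \<longrightarrow>
        (\<exists>!l. l \<in> hom C X (Dom C u) \<and> u \<odot> l = h \<and> v \<odot> l = k))"

text \<open>Fixed but arbitrary choices. For \<open>A\<close> over \<open>X\<close> and \<open>\<sigma>\<close> into \<open>X\<close>, the chosen pullback square has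
  the projections \<open>sub A \<sigma>\<close> (that is, \<open>\<sigma>\<^sup>*A\<close>) to \<open>Dom \<sigma>\<close> and \<open>proj A \<sigma>\<close> to \<open>Dom A\<close>.\<close>

definition unit_ob :: 'o where
  "unit_ob = (SOME T. terminal T)"

definition pb :: "'a \<Rightarrow> 'a \<Rightarrow> 'a \<times> 'a" where
  "pb s f = (SOME (u, v). is_pullback s f u v)"

definition sub :: "'a \<Rightarrow> 'a \<Rightarrow> 'a" where
  "sub A \<sigma> = fst (pb \<sigma> A)"

definition proj :: "'a \<Rightarrow> 'a \<Rightarrow> 'a" where
  "proj A \<sigma> = snd (pb \<sigma> A)"

definition pair :: "'a \<Rightarrow> 'a \<Rightarrow> 'a \<Rightarrow> 'a \<Rightarrow> 'a" where
  "pair A \<sigma> h k =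
     (THE l. l \<in> hom C (Dom C h) (Dom C (sub A \<sigma>)) \<and> sub A \<sigma> \<odot> l = h \<and> proj A \<sigma> \<odot> l = k)"

text \<open>Pullback along \<open>\<sigma>\<close> of an arrow \<open>h\<close> over \<open>X\<close> from \<open>A\<close> to \<open>B\<close>.\<close>

definition sub_map :: "'a \<Rightarrow> 'a \<Rightarrow> 'a \<Rightarrow> 'a \<Rightarrow> 'a" where
  "sub_map \<sigma> A h B = pair B \<sigma> (sub A \<sigma>) (h \<odot> proj A \<sigma>)"


section \<open>Path objects\<close>

text \<open>The square \<open>A \<times>\<^sub>X A\<close> of an object \<open>A\<close> of the slice over \<open>X\<close>, as an object over \<open>X\<close>, its action
  on arrows over \<open>X\<close>, and the diagonal. Its first projection is \<open>sub A A\<close>, its second \<open>proj A A\<close>.\<close>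

definition sq :: "'a \<Rightarrow> 'a" where
  "sq A = A \<odot> sub A A"

definition sq_map :: "'a \<times> 'a \<times> 'a \<Rightarrow> 'a \<times> 'a \<times> 'a" where
  "sq_map = (\<lambda>(A, h, B). (sq A, pair B B (h \<odot> sub A A) (h \<odot> proj A A), sq B))"

definition diag :: "'a \<Rightarrow> 'a" where
  "diag A = pair A A (Idt C (Dom C A)) (Idt C (Dom C A))"

definition path_object :: "'a set \<Rightarrow> 'a set \<Rightarrow> 'a \<Rightarrow> 'a \<Rightarrow> 'a \<Rightarrow> 'a \<Rightarrow> bool" where
  "path_object L R B E r p \<longleftrightarrow>
     (B, r, E) \<in> Ar (slice C (Cod C B)) \<and> (E, p, sq B) \<in> Ar (slice C (Cod C B)) \<and>
     p \<odot> r = diag B \<and> r \<in> L \<and> p \<in> R"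

end

text \<open>An object \<open>B\<close> of a slice determines its base \<open>Cod B\<close>, so one record holds the data for all
  slices: \<open>PI B\<close> is the object \<open>B\<^sup>I\<close> over \<open>Cod B\<close>, \<open>PI_map\<close> the action on arrows of the slices,
  and \<open>rfl B\<close>, \<open>ends B\<close> are the underlying arrows of \<open>r\<close> and \<open>p\<close>. The choice in \<open>C\<close> itself is the
  one in the slice over the terminal object.\<close>

record 'a path_choice =
  PI :: "'a \<Rightarrow> 'a"
  PI_map :: "'a \<times> 'a \<times> 'a \<Rightarrow> 'a \<times> 'a \<times> 'a"
  rfl :: "'a \<Rightarrow> 'a"
  ends :: "'a \<Rightarrow> 'a"

definition functorial_path_objects ::
  "('o, 'a) cat \<Rightarrow> 'a set \<Rightarrow> 'a set \<Rightarrow> 'a path_choice \<Rightarrow> bool" where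
  "functorial_path_objects C L R P \<longleftrightarrow>
     (\<forall>X \<in> Ob C.
        let S = slice C X; F = full_sub S R in
        (\<forall>B \<in> Ob F. path_object C L R B (PI P B) (rfl P B) (ends P B)) \<and>
        is_functor F S (PI P) (PI_map P) \<and>
        nat_trans F S (\<lambda>B. B) (\<lambda>h. h) (PI P) (PI_map P) (\<lambda>B. (B, rfl P B, PI P B)) \<and>
        nat_trans F S (PI P) (PI_map P) (sq C) (sq_map C) (\<lambda>B. (PI P B, ends P B, sq C B)))"

context
  fixes C :: "('o, 'a) cat" (structure)
    and R :: "'a set"
    and P :: "'a path_choice"
begin

text \<open>The canonical \<open>\<sigma>\<^sup>*(B \<times>\<^sub>X B) \<cong> \<sigma>\<^sup>*B \<times>\<^sub>Y \<sigma>\<^sup>*B\<close>, for \<open>\<sigma>\<close> from \<open>Y\<close> to \<open>X\<close>.\<close>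

definition sq_sub :: "'a \<Rightarrow> 'a \<Rightarrow> 'a" where
  "sq_sub B \<sigma> = pair C (sub C B \<sigma>) (sub C B \<sigma>)
     (sub_map C \<sigma> (sq C B) (sub C B B) B) (sub_map C \<sigma> (sq C B) (proj C B B) B)"

definition stability_iso :: "'a \<Rightarrow> 'a \<Rightarrow> 'a \<Rightarrow> bool" where
  "stability_iso B \<sigma> \<phi> \<longleftrightarrow>
     iso (slice C (Dom C \<sigma>)) (sub C (PI P B) \<sigma>, \<phi>, PI P (sub C B \<sigma>)) \<and>
     \<phi> \<odot> sub_map C \<sigma> B (rfl P B) (PI P B) = rfl P (sub C B \<sigma>) \<and>
     ends P (sub C B \<sigma>) \<odot> \<phi> = sq_sub B \<sigma> \<odot> sub_map C \<sigma> (PI P B) (ends P B) (sq C B)"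

definition stable_under_substitution :: "('a \<Rightarrow> 'a \<Rightarrow> 'a) \<Rightarrow> bool" where
  "stable_under_substitution \<phi> \<longleftrightarrow>
     (\<forall>B \<in> R. \<forall>\<sigma> \<in> Ar C. Cod C \<sigma> = Cod C B \<longrightarrow> stability_iso B \<sigma> (\<phi> B \<sigma>))"


section \<open>Interpretation of judgements\<close>

text \<open>A telescope over \<open>X\<close> is a chain of fibrations ending in \<open>X\<close>, most recent one first; a context is
  a telescope over the terminal object.\<close>

primrec tip :: "'o \<Rightarrow> 'a list \<Rightarrow> 'o" where
  "tip X [] = X"
| "tip X (A # \<Theta>) = Dom C A"

primrec tele :: "'o \<Rightarrow> 'a list \<Rightarrow> bool" where
  "tele X [] \<longleftrightarrow> True"
| "tele X (A # \<Theta>) \<longleftrightarrow> tele X \<Theta> \<and> A \<in> R \<and> Cod C A = tip X \<Theta>"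

definition ctx :: "'a list \<Rightarrow> bool" where
  "ctx \<Gamma> \<longleftrightarrow> tele (unit_ob C) \<Gamma>"

definition ob :: "'a list \<Rightarrow> 'o" where
  "ob \<Gamma> = tip (unit_ob C) \<Gamma>"

text \<open>Types in context are fibrations, terms are sections. Definitional equality is identity, so the
  equivalence and congruence rules for it are those of HOL equality.\<close>

definition ty :: "'a list \<Rightarrow> 'a set" where
  "ty \<Gamma> = {A \<in> R. Cod C A = ob \<Gamma>}"

definition tm :: "'a \<Rightarrow> 'a set" where
  "tm A = {a \<in> hom C (Cod C A) (Dom C A). A \<odot> a = Idt C (Cod C A)}"

text \<open>Substitution in terms, and in telescopes, with the arrow that \<open>\<sigma>\<close> induces between the tips.\<close>

definition tm_sub :: "'a \<Rightarrow> 'a \<Rightarrow> 'a \<Rightarrow> 'a" where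
  "tm_sub A \<sigma> a = pair C A \<sigma> (Idt C (Dom C \<sigma>)) (a \<odot> \<sigma>)"

primrec lift :: "'a \<Rightarrow> 'a list \<Rightarrow> 'a" where
  "lift \<sigma> [] = \<sigma>"
| "lift \<sigma> (A # \<Theta>) = proj C A (lift \<sigma> \<Theta>)"

primrec tele_sub :: "'a \<Rightarrow> 'a list \<Rightarrow> 'a list" where
  "tele_sub \<sigma> [] = []"
| "tele_sub \<sigma> (A # \<Theta>) = sub C A (lift \<sigma> \<Theta>) # tele_sub \<sigma> \<Theta>"

text \<open>The last variable of \<open>\<Gamma>, x : A\<close>, a term of the weakening \<open>sub A A\<close> of \<open>A\<close> along \<open>A\<close>.\<close>

definition last_var :: "'a \<Rightarrow> 'a" where
  "last_var A = diag C A"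

text \<open>Canonical isomorphisms \<open>\<tau>\<^sup>*\<sigma>\<^sup>*A \<cong> (\<sigma>\<tau>)\<^sup>*A\<close> and \<open>1\<^sup>*A \<cong> A\<close>.\<close>

definition sub_comp :: "'a \<Rightarrow> 'a \<Rightarrow> 'a \<Rightarrow> 'a" where
  "sub_comp A \<sigma> \<tau> = pair C A (\<sigma> \<odot> \<tau>) (sub C (sub C A \<sigma>) \<tau>) (proj C A \<sigma> \<odot> proj C (sub C A \<sigma>) \<tau>)"

definition sub_idt :: "'a \<Rightarrow> 'a" where
  "sub_idt A = proj C A (Idt C (Cod C A))"

text \<open>\<open>Id\<^sub>A(a, b)\<close> is the pullback of \<open>p\<close> along \<open>(a, b)\<close>; \<open>Id_el A a b q\<close> is the arrow \<open>(a, b, q)\<close> into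
  \<open>A\<^sup>I\<close>, which interprets the context \<open>\<Gamma>, x : A, y : A, z : Id\<^sub>A(x, y)\<close>.\<close>

definition Id_ty :: "'a \<Rightarrow> 'a \<Rightarrow> 'a \<Rightarrow> 'a" where
  "Id_ty A a b = sub C (ends P A) (pair C A A a b)"

definition rfl_tm :: "'a \<Rightarrow> 'a \<Rightarrow> 'a" where
  "rfl_tm A a = pair C (ends P A) (pair C A A a a) (Idt C (Dom C a)) (rfl P A \<odot> a)"

definition Id_el :: "'a \<Rightarrow> 'a \<Rightarrow> 'a \<Rightarrow> 'a \<Rightarrow> 'a" where
  "Id_el A a b q = proj C (ends P A) (pair C A A a b) \<odot> q"

definition ctx_Id :: "'a list \<Rightarrow> 'a \<Rightarrow> 'a list" where
  "ctx_Id \<Gamma> A = ends P A # sub C A A # A # \<Gamma>"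

text \<open>\<open>J A D d\<close> stands for the arrow from \<open>A\<^sup>I\<close> to \<open>D\<close> interpreting \<open>J\<^bsub>A,D\<^esub>(d, x, y, z)\<close>. The type
  \<open>D(a, b, q)\<close> is \<open>sub D (Id_el A a b q)\<close>.\<close>

definition J_tm :: "('a \<Rightarrow> 'a \<Rightarrow> 'a \<Rightarrow> 'a) \<Rightarrow> 'a \<Rightarrow> 'a \<Rightarrow> 'a \<Rightarrow> 'a \<Rightarrow> 'a \<Rightarrow> 'a \<Rightarrow> 'a" where
  "J_tm J A D d a b q = tm_sub D (Id_el A a b q) (J A D d)"


section \<open>Validity of the rules\<close>

text \<open>A substitution along \<open>w\<close>, weakening included, takes types to types and terms to terms.\<close>

definition acts_on_judgements :: "'a list \<Rightarrow> 'a \<Rightarrow> 'a list \<Rightarrow> bool" where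
  "acts_on_judgements \<Delta> w \<Gamma> \<longleftrightarrow> ctx \<Delta> \<and> w \<in> hom C (ob \<Delta>) (ob \<Gamma>) \<and>
     (\<forall>A \<in> ty \<Gamma>. sub C A w \<in> ty \<Delta> \<and> (\<forall>a \<in> tm A. tm_sub A w a \<in> tm (sub C A w)))"

definition context_rules :: bool where
  "context_rules \<longleftrightarrow> terminal C (ob []) \<and> ctx [] \<and>
     (\<forall>\<Gamma> A. ctx \<Gamma> \<and> A \<in> ty \<Gamma> \<longrightarrow>
        ctx (A # \<Gamma>) \<and> sub C A A \<in> ty (A # \<Gamma>) \<and> last_var A \<in> tm (sub C A A))"

definition weakening_rule :: bool where
  "weakening_rule \<longleftrightarrow>
     (\<forall>\<Gamma> \<Theta> A. ctx (\<Theta> @ \<Gamma>) \<and> A \<in> ty \<Gamma> \<longrightarrow>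
        acts_on_judgements (tele_sub A \<Theta> @ A # \<Gamma>) (lift A \<Theta>) (\<Theta> @ \<Gamma>))"

definition substitution_rule :: bool where
  "substitution_rule \<longleftrightarrow>
     (\<forall>\<Gamma> A \<Theta> c. ctx (\<Theta> @ A # \<Gamma>) \<and> c \<in> tm A \<longrightarrow>
        acts_on_judgements (tele_sub c \<Theta> @ \<Gamma>) (lift c \<Theta>) (\<Theta> @ A # \<Gamma>))"

text \<open>The equations between substitutions, up to the canonical isomorphisms. Note that
  \<open>A \<odot> c = Idt C (Cod C A)\<close> for \<open>c \<in> tm A\<close>, so weakening followed by substitution is covered.\<close>

definition substitution_equations :: bool where
  "substitution_equations \<longleftrightarrow>
     (\<forall>\<Gamma>. ctx \<Gamma> \<longrightarrow> (\<forall>A \<in> ty \<Gamma>.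
        (\<forall>\<sigma> \<tau>. \<sigma> \<in> Ar C \<and> \<tau> \<in> Ar C \<and> Cod C \<sigma> = ob \<Gamma> \<and> Cod C \<tau> = Dom C \<sigma> \<longrightarrow>
           iso (slice C (Dom C \<tau>)) (sub C (sub C A \<sigma>) \<tau>, sub_comp A \<sigma> \<tau>, sub C A (\<sigma> \<odot> \<tau>)) \<and>
           (\<forall>a \<in> tm A. sub_comp A \<sigma> \<tau> \<odot> tm_sub (sub C A \<sigma>) \<tau> (tm_sub A \<sigma> a)
                       = tm_sub A (\<sigma> \<odot> \<tau>) a)) \<and>
        iso (slice C (ob \<Gamma>)) (sub C A (Idt C (ob \<Gamma>)), sub_idt A, A) \<and>
        (\<forall>a \<in> tm A. sub_idt A \<odot> tm_sub A (Idt C (ob \<Gamma>)) a = a) \<and>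
        (\<forall>c \<in> tm A. sub_idt A \<odot> sub_comp A A c \<odot> tm_sub (sub C A A) c (last_var A) = c)))"

definition Id_formation :: bool where
  "Id_formation \<longleftrightarrow>
     (\<forall>\<Gamma>. ctx \<Gamma> \<longrightarrow> (\<forall>A \<in> ty \<Gamma>.
        ends P A \<in> ty (sub C A A # A # \<Gamma>) \<and>
        (\<forall>a \<in> tm A. \<forall>b \<in> tm A. Id_ty A a b \<in> ty \<Gamma>)))"

definition Id_introduction :: bool where
  "Id_introduction \<longleftrightarrow>
     (\<forall>\<Gamma>. ctx \<Gamma> \<longrightarrow> (\<forall>A \<in> ty \<Gamma>. \<forall>a \<in> tm A. rfl_tm A a \<in> tm (Id_ty A a a)))"

text \<open>The hypothesis \<open>x : A \<turnstile> d(x) : D(x, x, r\<^sub>A(x))\<close> makes \<open>d\<close> a term of \<open>sub D (rfl P A)\<close>; the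
  corresponding arrow from \<open>A\<close> to \<open>D\<close> over \<open>A\<^sup>I\<close> is \<open>proj D (rfl P A) \<odot> d\<close>. Each rule is stated for
  variables \<open>x, y, z\<close> and for terms \<open>a, b, q\<close>.\<close>

definition Id_elimination :: "('a \<Rightarrow> 'a \<Rightarrow> 'a \<Rightarrow> 'a) \<Rightarrow> bool" where
  "Id_elimination J \<longleftrightarrow>
     (\<forall>\<Gamma>. ctx \<Gamma> \<longrightarrow> (\<forall>A \<in> ty \<Gamma>. \<forall>D \<in> ty (ctx_Id \<Gamma> A). \<forall>d \<in> tm (sub C D (rfl P A)).
        J A D d \<in> tm D \<and>
        (\<forall>a \<in> tm A. \<forall>b \<in> tm A. \<forall>q \<in> tm (Id_ty A a b).
           J_tm J A D d a b q \<in> tm (sub C D (Id_el A a b q)))))"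

definition Id_conversion :: "('a \<Rightarrow> 'a \<Rightarrow> 'a \<Rightarrow> 'a) \<Rightarrow> bool" where
  "Id_conversion J \<longleftrightarrow>
     (\<forall>\<Gamma>. ctx \<Gamma> \<longrightarrow> (\<forall>A \<in> ty \<Gamma>. \<forall>D \<in> ty (ctx_Id \<Gamma> A). \<forall>d \<in> tm (sub C D (rfl P A)).
        J A D d \<odot> rfl P A = proj C D (rfl P A) \<odot> d \<and>
        (\<forall>a \<in> tm A. J_tm J A D d a a (rfl_tm A a)
           = sub_comp D (rfl P A) a \<odot> tm_sub (sub C D (rfl P A)) a d)))"

context
  fixes \<phi> :: "'a \<Rightarrow> 'a \<Rightarrow> 'a"
begin

text \<open>The isomorphism \<open>\<sigma>\<^sup>*(Id\<^sub>A(a, b)) \<cong> Id\<^bsub>\<sigma>\<^sup>*A\<^esub>(\<sigma>\<^sup>*a, \<sigma>\<^sup>*b)\<close> induced by the stability isomorphism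
  \<open>\<phi> A \<sigma>\<close> from \<open>\<sigma>\<^sup>*(A\<^sup>I)\<close> to \<open>(\<sigma>\<^sup>*A)\<^sup>I\<close>.\<close>

definition Id_sub :: "'a \<Rightarrow> 'a \<Rightarrow> 'a \<Rightarrow> 'a \<Rightarrow> 'a" where
  "Id_sub A a b \<sigma> =
     pair C (ends P (sub C A \<sigma>))
       (pair C (sub C A \<sigma>) (sub C A \<sigma>) (tm_sub A \<sigma> a) (tm_sub A \<sigma> b))
       (sub C (Id_ty A a b) \<sigma>)
       (\<phi> A \<sigma> \<odot> pair C (PI P A) \<sigma> (sub C (Id_ty A a b) \<sigma>)
          (proj C (ends P A) (pair C A A a b) \<odot> proj C (Id_ty A a b) \<sigma>))"

definition Id_commutes :: "'a \<Rightarrow> 'a \<Rightarrow> 'a \<Rightarrow> 'a \<Rightarrow> bool" where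
  "Id_commutes A a b \<sigma> \<longleftrightarrow>
     iso (slice C (Dom C \<sigma>)) (sub C (Id_ty A a b) \<sigma>, Id_sub A a b \<sigma>,
        Id_ty (sub C A \<sigma>) (tm_sub A \<sigma> a) (tm_sub A \<sigma> b))"

definition rfl_commutes :: "'a \<Rightarrow> 'a \<Rightarrow> 'a \<Rightarrow> bool" where
  "rfl_commutes A a \<sigma> \<longleftrightarrow>
     Id_sub A a a \<sigma> \<odot> tm_sub (Id_ty A a a) \<sigma> (rfl_tm A a) = rfl_tm (sub C A \<sigma>) (tm_sub A \<sigma> a)"

text \<open>Besides \<open>\<Gamma>, x : X\<close>, the rules are stated for \<open>\<Gamma>, x : X, \<Theta>\<close>, the usual rules being those with
  \<open>\<Theta> = []\<close>.\<close>

definition Beck_Chevalley_Id :: bool where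
  "Beck_Chevalley_Id \<longleftrightarrow>
     (\<forall>\<Gamma> X \<Theta> c. ctx (\<Theta> @ X # \<Gamma>) \<and> c \<in> tm X \<longrightarrow>
        (\<forall>A \<in> ty (\<Theta> @ X # \<Gamma>). \<forall>a \<in> tm A. \<forall>b \<in> tm A. Id_commutes A a b (lift c \<Theta>)))"

definition Beck_Chevalley_rfl :: bool where
  "Beck_Chevalley_rfl \<longleftrightarrow>
     (\<forall>\<Gamma> X \<Theta> c. ctx (\<Theta> @ X # \<Gamma>) \<and> c \<in> tm X \<longrightarrow>
        (\<forall>A \<in> ty (\<Theta> @ X # \<Gamma>). \<forall>a \<in> tm A. rfl_commutes A a (lift c \<Theta>)))"

text \<open>Weakening leaves the expressions \<open>Id\<^sub>A(a, b)\<close> and \<open>r\<^sub>A(a)\<close> unchanged.\<close>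

definition weakening_Id :: bool where
  "weakening_Id \<longleftrightarrow>
     (\<forall>\<Gamma> \<Theta> X. ctx (\<Theta> @ \<Gamma>) \<and> X \<in> ty \<Gamma> \<longrightarrow>
        (\<forall>A \<in> ty (\<Theta> @ \<Gamma>). \<forall>a \<in> tm A. \<forall>b \<in> tm A.
           Id_commutes A a b (lift X \<Theta>) \<and> rfl_commutes A a (lift X \<Theta>)))"

text \<open>In \<open>\<Gamma>, x : A, y : A\<close> the type \<open>Id\<^sub>A(x, y)\<close> can be read as \<open>p\<close> or as \<open>Id\<^bsub>\<pi>\<^sup>*A\<^esub>(x, y)\<close>, where
  \<open>\<pi> = sq A\<close> is the projection to \<open>\<Gamma>\<close>; likewise \<open>r\<^sub>A(x)\<close> in \<open>\<Gamma>, x : A\<close> can be read as \<open>r\<close> or as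
  \<open>r\<^bsub>A\<^sup>*A\<^esub>(x)\<close>. The readings agree.\<close>

definition Id_variables :: bool where
  "Id_variables \<longleftrightarrow>
     (\<forall>\<Gamma>. ctx \<Gamma> \<longrightarrow> (\<forall>A \<in> ty \<Gamma>.
        let \<pi> = sq C A; A' = sub C A \<pi>; i = Idt C (Dom C (sub C A A));
            x = pair C A \<pi> i (sub C A A); y = pair C A \<pi> i (proj C A A)
        in iso (slice C (Dom C (sub C A A)))
             (ends P A,
              pair C (ends P A') (pair C A' A' x y) (ends P A)
                (\<phi> A \<pi> \<odot> pair C (PI P A) \<pi> (ends P A) (Idt C (Dom C (ends P A)))),
              Id_ty A' x y) \<and>
           Id_el (sub C A A) (last_var A) (last_var A) (rfl_tm (sub C A A) (last_var A))
             = \<phi> A A \<odot> pair C (PI P A) A (Idt C (Dom C A)) (rfl P A)))"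

definition models_identity_types :: "('a \<Rightarrow> 'a \<Rightarrow> 'a \<Rightarrow> 'a) \<Rightarrow> bool" where
  "models_identity_types J \<longleftrightarrow>
     context_rules \<and> weakening_rule \<and> substitution_rule \<and> substitution_equations \<and>
     Id_formation \<and> Id_introduction \<and> Id_elimination J \<and> Id_conversion J \<and>
     Beck_Chevalley_Id \<and> Beck_Chevalley_rfl \<and> weakening_Id \<and> Id_variables"

end

end

end

theory Submission
  imports Defs
begin

text \<open>Right maps are stable under pullback, which gives the structural rules and identity formation.
  Introduction is \<open>r\<close> itself, and since \<open>r\<close> is a left map, \<open>J\<close> is a lift of \<open>r\<close> against the
  fibration \<open>D\<close>. For Beck-Chevalley, \<open>(\<sigma>\<^sup>*A)\<^sup>I \<cong> \<sigma>\<^sup>*(A\<^sup>I)\<close> turns a pullback of \<open>p\<close> for \<open>A\<close> into a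
  pullback of \<open>p\<close> for \<open>\<sigma>\<^sup>*A\<close>; the two identity types are then pullbacks of the same cospan.\<close>

section \<open>Composition\<close>

text \<open>Pullbacks are only chosen up to isomorphism, so the substitution equations do not hold
  on the nose, and the isomorphism in each rule is prescribed. Most of these are by definition
  pairings into a chosen pullback, so their invertibility follows once their domain is shown to
  carry a pullback of the right cospan. A bare isomorphism \<open>\<sigma>\<^sup>*(A\<^sup>I)
  \<cong> (\<sigma>\<^sup>*A)\<^sup>I\<close> would not give this: compatibility with
  \<open>p\<close> matches the endpoints on the two sides, invertibility carries mediating arrows
  back, and compatibility with \<open>r\<close> is what reflexivity terms need. The commutations are
  proved along an arbitrary arrow into the base, so weakening (a projection) and substitution (a
  section), each under a telescope, are one argument. Lifts need not be coherent under pullback; the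
  eliminator is therefore chosen separately for all data, which suffices because the theory has no
  substitution rule for J-terms.\<close>

lemma hom_slice:
  "(f, h, g) \<in> Ar (slice C X) \<longleftrightarrow> f \<in> Ar C \<and> Cod C f = X \<and> g \<in> Ar C \<and> Cod C g = X \<and>
     h \<in> hom C (Dom C f) (Dom C g) \<and> Comp C g h = f"
  "Dom (slice C X) (f, h, g) = f" "Cod (slice C X) (f, h, g) = g"
  "Comp (slice C X) (g', k, e) (f, h, g) = (f, Comp C k h, e)"
  "Idt (slice C X) f = (f, Idt C (Dom C f), f)"
  by (simp_all add: slice_def)

text \<open>The tags of an inverse in the slice are forced to be \<open>g\<close> and
  \<open>f\<close>. Only its underlying arrow \<open>k\<close> is free, so later isomorphism proofs
  work with arrows of \<open>C\<close> instead of triples.\<close>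

lemma iso_slice_iff:
  fixes C (structure)
  shows "iso (slice C X) (f, h, g) \<longleftrightarrow>
     f \<in> Ar C \<and> Cod C f = X \<and> g \<in> Ar C \<and> Cod C g = X \<and>
     h \<in> hom C (Dom C f) (Dom C g) \<and> g \<odot> h = f \<and>
     (\<exists>k \<in> hom C (Dom C g) (Dom C f). f \<odot> k = g \<and>
        k \<odot> h = Idt C (Dom C f) \<and> h \<odot> k = Idt C (Dom C g))"
    (is "_ \<longleftrightarrow> ?R")
proof
  assume "iso (slice C X) (f, h, g)"
  then obtain g' k f' where
    "(f, h, g) \<in> Ar (slice C X)" "(g', k, f') \<in> hom (slice C X) g f"
    "Comp (slice C X) (g', k, f') (f, h, g) = Idt (slice C X) f"
    "Comp (slice C X) (f, h, g) (g', k, f') = Idt (slice C X) g"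
    unfolding iso_def hom_slice(2,3) by (metis prod_cases3)
  then show ?R
    unfolding hom_def[of "slice C X"] hom_slice mem_Collect_eq prod.inject by auto
next
  assume ?R
  then obtain k where "(f, h, g) \<in> Ar (slice C X)" "(g, k, f) \<in> hom (slice C X) g f"
    "Comp (slice C X) (g, k, f) (f, h, g) = Idt (slice C X) f"
    "Comp (slice C X) (f, h, g) (g, k, f) = Idt (slice C X) g"
    unfolding hom_def[of "slice C X"] hom_slice mem_Collect_eq prod.inject by blast
  then show "iso (slice C X) (f, h, g)"
    unfolding iso_def hom_slice(2,3) by blast
qed

context category
begin

lemma comp_arr [simp]:
  assumes "f \<in> Ar C" "g \<in> Ar C" "Cod C f = Dom C g"
  shows "g \<odot> f \<in> Ar C" "Dom C (g \<odot> f) = Dom C f" "Cod C (g \<odot> f) = Cod C g"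
  using Comp_hom[of f "Dom C f" "Dom C g" g "Cod C g"] assms by (auto simp: hom_def)

lemma idt_arr [simp]:
  assumes "A \<in> Ob C"
  shows "Idt C A \<in> Ar C" "Dom C (Idt C A) = A" "Cod C (Idt C A) = A"
  using Idt_hom[OF assms] by (auto simp: hom_def)

lemma comp_assoc [simp]:
  assumes "f \<in> Ar C" "g \<in> Ar C" "h \<in> Ar C" "Cod C f = Dom C g" "Cod C g = Dom C h"
  shows "(h \<odot> g) \<odot> f = h \<odot> (g \<odot> f)"
  using Comp_assoc[of f "Dom C f" "Dom C g" g "Dom C h" h "Cod C h"] assms by (auto simp: hom_def)

lemma comp_idt [simp]: "f \<in> Ar C \<Longrightarrow> Dom C f = A \<Longrightarrow> f \<odot> Idt C A = f"
  using Comp_Idt[of f A "Cod C f"] by (auto simp: hom_def)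

lemma idt_comp [simp]: "f \<in> Ar C \<Longrightarrow> Cod C f = B \<Longrightarrow> Idt C B \<odot> f = f"
  using Idt_Comp[of f "Dom C f" B] by (auto simp: hom_def)

text \<open>Composites are normalised to the right, which hides a known equation
  \<open>g \<odot> f = k\<close> inside \<open>g \<odot> (f \<odot> x)\<close>. This prolongs the
  equation by \<open>x\<close>; the later rules with a trailing \<open>x\<close> arise from
  it.\<close>

lemma comp_reassoc:
  assumes "g \<odot> f = k" "f \<in> Ar C" "g \<in> Ar C" "Cod C f = Dom C g" "x \<in> Ar C" "Cod C x = Dom C f"
  shows "g \<odot> (f \<odot> x) = k \<odot> x"
  using comp_assoc[of x f g] assms by simp

lemmas dom_cod_Ob [simp] = Dom_Ob Cod_Ob

end


section \<open>Terminal objects and pullbacks from finite limits\<close>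

definition empty_cat :: "(nat, nat) cat" where
  "empty_cat = \<lparr>Ob = {}, Ar = {}, Dom = id, Cod = id, Idt = id, Comp = (\<lambda>g f. g)\<rparr>"

text \<open>The shape \<open>0 \<rightarrow> 2 \<leftarrow> 1\<close>: the arrows \<open>0\<close>, \<open>1\<close>, \<open>2\<close> are the identities, \<open>3\<close> goes from \<open>0\<close> to \<open>2\<close>,
  \<open>4\<close> from \<open>1\<close> to \<open>2\<close>.\<close>

definition cospan_cat :: "(nat, nat) cat" where
  "cospan_cat = \<lparr>Ob = {0, 1, 2}, Ar = {0, 1, 2, 3, 4},
     Dom = (\<lambda>u. if u = 3 then 0 else if u = 4 then 1 else u),
     Cod = (\<lambda>u. if u = 3 \<or> u = 4 then 2 else u),
     Idt = id, Comp = (\<lambda>g f. if f < 3 then g else f)\<rparr>"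

lemma category_empty_cat: "category empty_cat"
  by unfold_locales (auto simp: empty_cat_def hom_def)

text \<open>Two non-identity arrows of this shape never compose, so every composite has an identity
  factor; the test \<open>f < 3\<close> in \<open>Comp\<close> finds out which factor to
  return.\<close>

lemma category_cospan_cat: "category cospan_cat"
  by unfold_locales (auto simp: cospan_cat_def hom_def split: if_splits)

locale finitely_complete_category = category +
  assumes fin_complete: "finitely_complete C"
begin

lemma terminal_unit_ob: "terminal C (unit_ob C)"
proof -
  \<comment> \<open>A cone over the empty diagram is just an object, and no value of the functor is
    ever consulted.\<close>
  have "is_functor empty_cat C undefined undefined"
    by (simp add: is_functor_def empty_cat_def)
  moreover have "finite (Ob empty_cat)" "finite (Ar empty_cat)"
    by (simp_all add: empty_cat_def)
  ultimately obtain T \<pi> where "is_limit empty_cat C undefined undefined T \<pi>"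
    using fin_complete category_empty_cat unfolding finitely_complete_def by blast
  then have "terminal C T"
    by (auto simp: terminal_def is_limit_def is_cone_def empty_cat_def)
  then show ?thesis
    unfolding unit_ob_def by (rule someI)
qed

lemma pullback_exists:
  assumes "s \<in> Ar C" "f \<in> Ar C" "Cod C s = Cod C f"
  shows "\<exists>u v. is_pullback C s f u v"
proof -
  define Fo where "Fo = (\<lambda>j::nat. if j = 0 then Dom C s else if j = 1 then Dom C f else Cod C f)"
  define Fa where "Fa = (\<lambda>u::nat. if u = 3 then s else if u = 4 then f else Idt C (Fo u))"
  have "is_functor cospan_cat C Fo Fa"
    using assms by (auto simp: is_functor_def cospan_cat_def hom_def Fo_def Fa_def)
  moreover have "finite (Ob cospan_cat)" "finite (Ar cospan_cat)"
    by (simp_all add: cospan_cat_def)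
  ultimately obtain W \<pi> where lim: "is_limit cospan_cat C Fo Fa W \<pi>"
    using fin_complete category_cospan_cat unfolding finitely_complete_def by blast
  have cone: "\<pi> 0 \<in> hom C W (Dom C s)" "\<pi> 1 \<in> hom C W (Dom C f)" "\<pi> 2 \<in> hom C W (Cod C f)"
    "s \<odot> \<pi> 0 = \<pi> 2" "f \<odot> \<pi> 1 = \<pi> 2"
    using lim by (auto simp: is_limit_def is_cone_def cospan_cat_def Fo_def Fa_def)
  have "\<exists>!l. l \<in> hom C X W \<and> \<pi> 0 \<odot> l = h \<and> \<pi> 1 \<odot> l = k"
    if hk: "h \<in> hom C X (Dom C s)" "k \<in> hom C X (Dom C f)" "s \<odot> h = f \<odot> k" for X h k
  proof -
    define \<mu> where "\<mu> = (\<lambda>j::nat. if j = 0 then h else if j = 1 then k else f \<odot> k)"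
    have "is_cone cospan_cat C Fo Fa X \<mu>"
      using hk assms by (auto simp: is_cone_def cospan_cat_def hom_def Fo_def Fa_def \<mu>_def)
    then have ex: "\<exists>!l. l \<in> hom C X W \<and> (\<forall>j \<in> Ob cospan_cat. \<pi> j \<odot> l = \<mu> j)"
      using lim by (auto simp: is_limit_def)
    \<comment> \<open>The leg at the vertex \<open>2\<close> is determined by the leg at
      \<open>1\<close>, so agreement on three legs reduces to agreement on two.\<close>
    have "(\<forall>j \<in> Ob cospan_cat. \<pi> j \<odot> l = \<mu> j) \<longleftrightarrow> \<pi> 0 \<odot> l = h \<and> \<pi> 1 \<odot> l = k"
      if "l \<in> hom C X W" for l
    proof -
      have "\<pi> 2 \<odot> l = f \<odot> (\<pi> 1 \<odot> l)"
        using cone that assms comp_reassoc[of f "\<pi> 1" "\<pi> 2" l] by (simp add: hom_def)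
      then show ?thesis
        by (auto simp: cospan_cat_def \<mu>_def)
    qed
    then show ?thesis
      using ex by (metis (no_types, lifting))
  qed
  then have "is_pullback C s f (\<pi> 0) (\<pi> 1)"
    using cone assms by (auto simp: is_pullback_def hom_def)
  then show ?thesis by blast
qed

lemma is_pullback_D:
  assumes "is_pullback C s f u v"
  shows "s \<in> Ar C" "f \<in> Ar C" "Cod C s = Cod C f" "u \<in> Ar C" "v \<in> Ar C" "Dom C v = Dom C u"
    "Cod C u = Dom C s" "Cod C v = Dom C f" "f \<odot> v = s \<odot> u"
  using assms unfolding is_pullback_def hom_def mem_Collect_eq by metis+

lemma is_pullback_sub_proj:
  assumes "A \<in> Ar C" "\<sigma> \<in> Ar C" "Cod C A = Cod C \<sigma>"
  shows "is_pullback C \<sigma> A (sub C A \<sigma>) (proj C A \<sigma>)"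
proof -
  obtain u v where "is_pullback C \<sigma> A u v"
    using pullback_exists[OF assms(2,1) assms(3)[symmetric]] by blast
  then have "case pb C \<sigma> A of (u, v) \<Rightarrow> is_pullback C \<sigma> A u v"
    unfolding pb_def by (intro someI[where P = "\<lambda>(u, v). is_pullback C \<sigma> A u v" and x = "(u, v)"]) simp
  then show ?thesis
    unfolding sub_def proj_def case_prod_beta .
qed

lemma is_pullback_universal:
  assumes pull: "is_pullback C s f u v"
    and hk: "h \<in> Ar C" "k \<in> Ar C" "Dom C k = Dom C h" "Cod C h = Dom C s" "Cod C k = Dom C f"
    and eq: "s \<odot> h = f \<odot> k"
  shows "\<exists>!l. l \<in> hom C (Dom C h) (Dom C u) \<and> u \<odot> l = h \<and> v \<odot> l = k"
proof -
  have "h \<in> hom C (Dom C h) (Dom C s)" "k \<in> hom C (Dom C h) (Dom C f)"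
    unfolding hom_def using hk by blast+
  with pull eq show ?thesis
    unfolding is_pullback_def by blast
qed

text \<open>The legs of a pullback are jointly monic: \<open>l\<close> and \<open>m\<close> both
  mediate the cone \<open>(u \<odot> m, v \<odot> m)\<close>.\<close>

lemma is_pullback_eqI:
  assumes pull: "is_pullback C s f u v"
    and "l \<in> Ar C" "m \<in> Ar C" "Dom C l = Dom C m" "Cod C l = Dom C u" "Cod C m = Dom C u"
    and "u \<odot> l = u \<odot> m" "v \<odot> l = v \<odot> m"
  shows "l = m"
proof -
  note [simp] = is_pullback_D[OF pull]
  have "f \<odot> (v \<odot> m) = s \<odot> (u \<odot> m)"
    using assms comp_reassoc[of f v "s \<odot> u" m] by simp
  then have "\<exists>!n. n \<in> hom C (Dom C (u \<odot> m)) (Dom C u) \<and> u \<odot> n = u \<odot> m \<and> v \<odot> n = v \<odot> m"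
    by (intro is_pullback_universal[OF pull]) (use assms in simp_all)
  moreover have "l \<in> hom C (Dom C (u \<odot> m)) (Dom C u)" "m \<in> hom C (Dom C (u \<odot> m)) (Dom C u)"
    using assms by (simp_all add: hom_def)
  ultimately show ?thesis
    using assms(7,8) by blast
qed

text \<open>Unique existence is split into existence and joint monicity of the legs, because the
  latter mentions no cone and can be proved by cancelling projections.\<close>

lemma is_pullbackI:
  assumes "s \<in> Ar C" "f \<in> Ar C" "Cod C s = Cod C f" "u \<in> Ar C" "v \<in> Ar C" "Dom C v = Dom C u"
    "Cod C u = Dom C s" "Cod C v = Dom C f" "f \<odot> v = s \<odot> u"
    and ex: "\<And>h k. \<lbrakk>h \<in> Ar C; k \<in> Ar C; Dom C k = Dom C h; Cod C h = Dom C s; Cod C k = Dom C f;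
      f \<odot> k = s \<odot> h\<rbrakk> \<Longrightarrow> \<exists>l \<in> Ar C. Dom C l = Dom C h \<and> Cod C l = Dom C u \<and> u \<odot> l = h \<and> v \<odot> l = k"
    and uniq: "\<And>l m. \<lbrakk>l \<in> Ar C; m \<in> Ar C; Dom C l = Dom C m; Cod C l = Dom C u; Cod C m = Dom C u;
      u \<odot> l = u \<odot> m; v \<odot> l = v \<odot> m\<rbrakk> \<Longrightarrow> l = m"
  shows "is_pullback C s f u v"
proof -
  have uni: "\<exists>!l. l \<in> hom C X (Dom C u) \<and> u \<odot> l = h \<and> v \<odot> l = k"
    if "h \<in> hom C X (Dom C s)" "k \<in> hom C X (Dom C f)" "s \<odot> h = f \<odot> k" for X h k
  proof -
    have "h \<in> Ar C" "k \<in> Ar C" "Dom C h = X" "Dom C k = X" "Cod C h = Dom C s" "Cod C k = Dom C f"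
      using that unfolding hom_def by blast+
    then obtain l where l: "l \<in> Ar C" "Dom C l = X" "Cod C l = Dom C u" "u \<odot> l = h" "v \<odot> l = k"
      using ex[of h k] \<open>s \<odot> h = f \<odot> k\<close> by metis
    moreover have "m = l" if "m \<in> Ar C" "Dom C m = X" "Cod C m = Dom C u" "u \<odot> m = h" "v \<odot> m = k" for m
      by (rule uniq) (simp_all only: that l)
    ultimately show ?thesis
      unfolding hom_def mem_Collect_eq by blast
  qed
  show ?thesis
    unfolding is_pullback_def
    by (intro conjI allI ballI impI uni) (use assms(1-9) in \<open>simp_all add: hom_def\<close>)
qed

section \<open>Chosen pullbacks, pairings and pasting\<close>

lemma sub_proj_arr [simp]:
  assumes "A \<in> Ar C" "\<sigma> \<in> Ar C" "Cod C A = Cod C \<sigma>"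
  shows "sub C A \<sigma> \<in> Ar C" "proj C A \<sigma> \<in> Ar C" "Dom C (proj C A \<sigma>) = Dom C (sub C A \<sigma>)"
    "Cod C (sub C A \<sigma>) = Dom C \<sigma>" "Cod C (proj C A \<sigma>) = Dom C A"
    "A \<odot> proj C A \<sigma> = \<sigma> \<odot> sub C A \<sigma>"
  using is_pullback_D[OF is_pullback_sub_proj[OF assms]] by blast+

lemma sub_proj_square [simp]:
  assumes "A \<in> Ar C" "\<sigma> \<in> Ar C" "Cod C A = Cod C \<sigma>" "x \<in> Ar C" "Cod C x = Dom C (sub C A \<sigma>)"
  shows "A \<odot> (proj C A \<sigma> \<odot> x) = \<sigma> \<odot> (sub C A \<sigma> \<odot> x)"
  using assms comp_reassoc[of A "proj C A \<sigma>" _ x] by simp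

lemma pair_eqI:
  assumes "A \<in> Ar C" "\<sigma> \<in> Ar C" "Cod C A = Cod C \<sigma>"
    and "l \<in> Ar C" "l' \<in> Ar C" "Dom C l = Dom C l'"
    and "Cod C l = Dom C (sub C A \<sigma>)" "Cod C l' = Dom C (sub C A \<sigma>)"
    and "sub C A \<sigma> \<odot> l = sub C A \<sigma> \<odot> l'" "proj C A \<sigma> \<odot> l = proj C A \<sigma> \<odot> l'"
  shows "l = l'"
  by (rule is_pullback_eqI[OF is_pullback_sub_proj[OF assms(1-3)]]) (use assms in simp_all)

lemma pair_arr [simp]:
  assumes "A \<in> Ar C" "\<sigma> \<in> Ar C" "Cod C A = Cod C \<sigma>"
    and "h \<in> Ar C" "k \<in> Ar C" "Dom C h = Dom C k" "Cod C h = Dom C \<sigma>" "Cod C k = Dom C A"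
    and "\<sigma> \<odot> h = A \<odot> k"
  shows "pair C A \<sigma> h k \<in> Ar C" "Dom C (pair C A \<sigma> h k) = Dom C h"
    "Cod C (pair C A \<sigma> h k) = Dom C (sub C A \<sigma>)"
    "sub C A \<sigma> \<odot> pair C A \<sigma> h k = h" "proj C A \<sigma> \<odot> pair C A \<sigma> h k = k"
proof -
  have "\<exists>!l. l \<in> hom C (Dom C h) (Dom C (sub C A \<sigma>)) \<and> sub C A \<sigma> \<odot> l = h \<and> proj C A \<sigma> \<odot> l = k"
    by (rule is_pullback_universal[OF is_pullback_sub_proj[OF assms(1-3)]]) (use assms in simp_all)
  from theI'[OF this]
  show "pair C A \<sigma> h k \<in> Ar C" "Dom C (pair C A \<sigma> h k) = Dom C h"
    "Cod C (pair C A \<sigma> h k) = Dom C (sub C A \<sigma>)"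
    "sub C A \<sigma> \<odot> pair C A \<sigma> h k = h" "proj C A \<sigma> \<odot> pair C A \<sigma> h k = k"
    by (auto simp: pair_def hom_def)
qed

lemma pair_comp [simp]:
  assumes "A \<in> Ar C" "\<sigma> \<in> Ar C" "Cod C A = Cod C \<sigma>"
    and "h \<in> Ar C" "k \<in> Ar C" "Dom C h = Dom C k" "Cod C h = Dom C \<sigma>" "Cod C k = Dom C A"
    and "\<sigma> \<odot> h = A \<odot> k" "x \<in> Ar C" "Cod C x = Dom C h"
  shows "sub C A \<sigma> \<odot> (pair C A \<sigma> h k \<odot> x) = h \<odot> x"
    "proj C A \<sigma> \<odot> (pair C A \<sigma> h k \<odot> x) = k \<odot> x"
  using assms comp_reassoc[of "sub C A \<sigma>" "pair C A \<sigma> h k" h x]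
    comp_reassoc[of "proj C A \<sigma>" "pair C A \<sigma> h k" k x] by simp_all

text \<open>Any pullback is compared with the chosen one of the same cospan. The arrows
  \<open>sub_comp\<close>, \<open>Id_sub\<close> and the one in \<open>Id_variables\<close> have
  exactly this form, so for each of them only a pullback has to be exhibited.\<close>

lemma iso_slice_pullback:
  assumes A: "A \<in> Ar C" "\<sigma> \<in> Ar C" "Cod C A = Cod C \<sigma>"
    and pull: "is_pullback C \<sigma> A u v"
  shows "iso (slice C (Dom C \<sigma>)) (u, pair C A \<sigma> u v, sub C A \<sigma>)"
proof -
  have uv [simp]: "u \<in> Ar C" "v \<in> Ar C" "Dom C v = Dom C u" "Cod C u = Dom C \<sigma>"
    "Cod C v = Dom C A" "A \<odot> v = \<sigma> \<odot> u"
    using is_pullback_D[OF pull] by blast+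
  let ?h = "pair C A \<sigma> u v"
  have uni: "\<exists>!l. l \<in> hom C X (Dom C u) \<and> u \<odot> l = h \<and> v \<odot> l = k"
    if "h \<in> hom C X (Dom C \<sigma>)" "k \<in> hom C X (Dom C A)" "\<sigma> \<odot> h = A \<odot> k" for X h k
    using pull that by (auto simp: is_pullback_def)
  obtain l where l: "l \<in> hom C (Dom C (sub C A \<sigma>)) (Dom C u)"
      "u \<odot> l = sub C A \<sigma>" "v \<odot> l = proj C A \<sigma>"
    using uni[of "sub C A \<sigma>" "Dom C (sub C A \<sigma>)" "proj C A \<sigma>"] A by (auto simp: hom_def)
  have l' [simp]: "l \<in> Ar C" "Dom C l = Dom C (sub C A \<sigma>)" "Cod C l = Dom C u"
    using l by (auto simp: hom_def)
  have "?h \<odot> l = Idt C (Dom C (sub C A \<sigma>))"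
    by (rule pair_eqI[of A \<sigma>]) (use A l in simp_all)
  \<comment> \<open>The composite and the identity both mediate the cone \<open>(u, v)\<close> into
    its own vertex.\<close>
  moreover have "l \<odot> ?h = Idt C (Dom C u)"
  proof -
    have "u \<odot> (l \<odot> ?h) = u" "v \<odot> (l \<odot> ?h) = v"
      using A l comp_reassoc[of u l _ ?h] comp_reassoc[of v l _ ?h] by simp_all
    moreover have "\<exists>!m. m \<in> hom C (Dom C u) (Dom C u) \<and> u \<odot> m = u \<and> v \<odot> m = v"
      by (rule uni) (auto simp: hom_def)
    moreover have "l \<odot> ?h \<in> hom C (Dom C u) (Dom C u)" "Idt C (Dom C u) \<in> hom C (Dom C u) (Dom C u)"
      using A by (auto simp: hom_def)
    moreover have "u \<odot> Idt C (Dom C u) = u" "v \<odot> Idt C (Dom C u) = v"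
      by simp_all
    ultimately show ?thesis by blast
  qed
  ultimately show ?thesis
    using A l by (auto simp: iso_slice_iff hom_def intro!: exI[of _ l])
qed

text \<open>Serves twice: with a type \<open>A\<close> it compares iterated substitution with
  substitution along a composite, and with \<open>A\<close> replaced by \<open>p\<close> it
  describes a substituted identity type.\<close>

lemma pullback_paste:
  assumes A: "A \<in> Ar C" "\<sigma> \<in> Ar C" "\<tau> \<in> Ar C" "Cod C A = Cod C \<sigma>" "Cod C \<tau> = Dom C \<sigma>"
  shows "is_pullback C (\<sigma> \<odot> \<tau>) A (sub C (sub C A \<sigma>) \<tau>) (proj C A \<sigma> \<odot> proj C (sub C A \<sigma>) \<tau>)"
proof (rule is_pullbackI)
  fix h k assume "h \<in> Ar C" "k \<in> Ar C" "Dom C k = Dom C h" "Cod C h = Dom C (\<sigma> \<odot> \<tau>)"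
    "Cod C k = Dom C A" "A \<odot> k = (\<sigma> \<odot> \<tau>) \<odot> h"
  then show "\<exists>l\<in>Ar C. Dom C l = Dom C h \<and> Cod C l = Dom C (sub C (sub C A \<sigma>) \<tau>) \<and>
      sub C (sub C A \<sigma>) \<tau> \<odot> l = h \<and> (proj C A \<sigma> \<odot> proj C (sub C A \<sigma>) \<tau>) \<odot> l = k"
    \<comment> \<open>The cone is filled one square at a time: \<open>k\<close> is paired with
      \<open>\<tau> \<odot> h\<close> over \<open>\<sigma>\<close>, and the result with
      \<open>h\<close> over \<open>\<tau>\<close>.\<close>
    using A by (intro bexI[of _ "pair C (sub C A \<sigma>) \<tau> h (pair C A \<sigma> (\<tau> \<odot> h) k)"]) simp_all
next
  fix l m assume lm: "l \<in> Ar C" "m \<in> Ar C" "Dom C l = Dom C m"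
    "Cod C l = Dom C (sub C (sub C A \<sigma>) \<tau>)" "Cod C m = Dom C (sub C (sub C A \<sigma>) \<tau>)"
    "sub C (sub C A \<sigma>) \<tau> \<odot> l = sub C (sub C A \<sigma>) \<tau> \<odot> m"
    "(proj C A \<sigma> \<odot> proj C (sub C A \<sigma>) \<tau>) \<odot> l = (proj C A \<sigma> \<odot> proj C (sub C A \<sigma>) \<tau>) \<odot> m"
  have "proj C (sub C A \<sigma>) \<tau> \<odot> l = proj C (sub C A \<sigma>) \<tau> \<odot> m"
    by (rule pair_eqI[of A \<sigma>]) (use A lm in simp_all)
  with lm show "l = m"
    using A pair_eqI[of "sub C A \<sigma>" \<tau> l m] by simp
qed (use A in simp_all)

lemma pullback_idt:
  assumes "A \<in> Ar C" "X = Cod C A"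
  shows "is_pullback C (Idt C X) A A (Idt C (Dom C A))"
  by (rule is_pullbackI) (use assms in auto)

lemma tm_D:
  assumes "a \<in> tm C A"
  shows "a \<in> Ar C" "Dom C a = Cod C A" "Cod C a = Dom C A" "A \<odot> a = Idt C (Cod C A)"
  using assms by (auto simp: tm_def hom_def)

lemma tm_sub_tm:
  assumes "A \<in> Ar C" "\<sigma> \<in> Ar C" "Cod C A = Cod C \<sigma>" "a \<in> tm C A"
  shows "tm_sub C A \<sigma> a \<in> tm C (sub C A \<sigma>)"
proof -
  note a = tm_D[OF assms(4)]
  have "A \<odot> (a \<odot> \<sigma>) = \<sigma>"
    using assms a comp_reassoc[OF a(4), of \<sigma>] by simp
  then show ?thesis
    using assms a by (simp add: tm_sub_def tm_def hom_def)
qed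

end


section \<open>Stable path objects\<close>

locale stable_path_category = finitely_complete_category +
  fixes L R :: "'a set" and P :: "'a path_choice" and \<phi> :: "'a \<Rightarrow> 'a \<Rightarrow> 'a"
  assumes wfs: "weak_factorization_system C L R"
    and paths: "functorial_path_objects C L R P"
    and stable: "stable_under_substitution C R P \<phi>"
begin

lemma R_Ar [simp]: "f \<in> R \<Longrightarrow> f \<in> Ar C"
  using wfs unfolding weak_factorization_system_def by blast

lemma L_Ar: "f \<in> L \<Longrightarrow> f \<in> Ar C"
  using wfs unfolding weak_factorization_system_def by blast

lemma lifting:
  assumes "m \<in> L" "g \<in> R" "h \<in> Ar C" "k \<in> Ar C" "Dom C h = Dom C m" "Cod C h = Dom C g"
    "Dom C k = Cod C m" "Cod C k = Cod C g" "g \<odot> h = k \<odot> m"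
  shows "\<exists>l \<in> hom C (Cod C m) (Dom C g). g \<odot> l = k \<and> l \<odot> m = h"
proof -
  have "lifts C m g"
    using wfs assms(1,2) unfolding weak_factorization_system_def by blast
  moreover have "h \<in> hom C (Dom C m) (Dom C g)" "k \<in> hom C (Cod C m) (Cod C g)"
    unfolding hom_def using assms by blast+
  ultimately show ?thesis
    using assms(9) unfolding lifts_def by blast
qed

lemma sub_R [simp]:
  assumes A: "A \<in> R" "\<sigma> \<in> Ar C" "Cod C A = Cod C \<sigma>"
  shows "sub C A \<sigma> \<in> R"
proof -
  have "lifts C m (sub C A \<sigma>)" if m: "m \<in> L" for m
    unfolding lifts_def
  proof (intro ballI impI)
    fix h k assume "h \<in> hom C (Dom C m) (Dom C (sub C A \<sigma>))" "k \<in> hom C (Cod C m) (Cod C (sub C A \<sigma>))"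
      and sq: "sub C A \<sigma> \<odot> h = k \<odot> m"
    then have hk: "h \<in> Ar C" "k \<in> Ar C" "Dom C h = Dom C m" "Cod C h = Dom C (sub C A \<sigma>)"
      "Dom C k = Cod C m" "Cod C k = Dom C \<sigma>"
      using A by (simp_all add: hom_def)
    \<comment> \<open>Extend the lifting problem by the pullback square to one against
      \<open>A\<close>. Its solution, paired with \<open>k\<close>, solves the original problem; the
      upper triangle is checked on the two projections.\<close>
    have "\<exists>l \<in> hom C (Cod C m) (Dom C A). A \<odot> l = \<sigma> \<odot> k \<and> l \<odot> m = proj C A \<sigma> \<odot> h"
      by (rule lifting[OF m A(1)]) (use A hk L_Ar[OF m] sq in simp_all)
    then obtain l where l: "l \<in> Ar C" "Dom C l = Cod C m" "Cod C l = Dom C A"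
        "A \<odot> l = \<sigma> \<odot> k" "l \<odot> m = proj C A \<sigma> \<odot> h"
      by (auto simp: hom_def)
    have "pair C A \<sigma> k l \<odot> m = h"
      by (rule pair_eqI[of A \<sigma>]) (use A hk l L_Ar[OF m] sq in simp_all)
    then show "\<exists>l \<in> hom C (Cod C m) (Dom C (sub C A \<sigma>)). sub C A \<sigma> \<odot> l = k \<and> l \<odot> m = h"
      using A hk l by (intro bexI[of _ "pair C A \<sigma> k l"]) (simp_all add: hom_def)
  qed
  moreover have "sub C A \<sigma> \<in> Ar C"
    using A by simp
  moreover have "{g \<in> Ar C. \<forall>m \<in> L. lifts C m g} = R"
    using wfs unfolding weak_factorization_system_def by blast
  ultimately show ?thesis by blast
qed

section \<open>Path objects and the stability isomorphism\<close>

lemma sq_arr [simp]: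
  assumes "B \<in> Ar C"
  shows "sq C B \<in> Ar C" "Dom C (sq C B) = Dom C (sub C B B)" "Cod C (sq C B) = Cod C B"
  using assms by (simp_all add: sq_def)

lemma path_object:
  assumes "B \<in> R"
  shows "path_object C L R B (PI P B) (rfl P B) (ends P B)"
proof -
  have "B \<in> Ob (full_sub (slice C (Cod C B)) R)" "Cod C B \<in> Ob C"
    using assms by (simp_all add: full_sub_def slice_def)
  then show ?thesis
    using paths unfolding functorial_path_objects_def Let_def by blast
qed

lemma path_arr [simp]:
  assumes "B \<in> R"
  shows "PI P B \<in> Ar C" "Cod C (PI P B) = Cod C B"
    "rfl P B \<in> Ar C" "Dom C (rfl P B) = Dom C B" "Cod C (rfl P B) = Dom C (PI P B)"
    "ends P B \<in> R" "Dom C (ends P B) = Dom C (PI P B)" "Cod C (ends P B) = Dom C (sub C B B)"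
    "rfl P B \<in> L" "PI P B \<odot> rfl P B = B" "sq C B \<odot> ends P B = PI P B" "ends P B \<odot> rfl P B = diag C B"
  using path_object[OF assms] assms by (simp_all add: path_object_def hom_slice hom_def)

lemma path_comp [simp]:
  assumes "B \<in> R" "x \<in> Ar C"
  shows "Cod C x = Dom C B \<Longrightarrow> PI P B \<odot> (rfl P B \<odot> x) = B \<odot> x"
    "Cod C x = Dom C (PI P B) \<Longrightarrow> sq C B \<odot> (ends P B \<odot> x) = PI P B \<odot> x"
    "Cod C x = Dom C B \<Longrightarrow> ends P B \<odot> (rfl P B \<odot> x) = diag C B \<odot> x"
  using assms comp_reassoc[of "PI P B" "rfl P B" B x] comp_reassoc[of "sq C B" "ends P B" "PI P B" x]
    comp_reassoc[of "ends P B" "rfl P B" "diag C B" x] by simp_all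

lemma stability:
  assumes "B \<in> R" "\<sigma> \<in> Ar C" "Cod C B = Cod C \<sigma>"
  shows "stability_iso C P B \<sigma> (\<phi> B \<sigma>)"
  using stable assms unfolding stable_under_substitution_def by simp

lemma stability_arr [simp]:
  assumes "B \<in> R" "\<sigma> \<in> Ar C" "Cod C B = Cod C \<sigma>"
  shows "\<phi> B \<sigma> \<in> Ar C" "Dom C (\<phi> B \<sigma>) = Dom C (sub C (PI P B) \<sigma>)"
    "Cod C (\<phi> B \<sigma>) = Dom C (PI P (sub C B \<sigma>))"
  using stability[OF assms] by (simp_all add: stability_iso_def iso_slice_iff hom_def)

lemma stability_inverse:
  assumes "B \<in> R" "\<sigma> \<in> Ar C" "Cod C B = Cod C \<sigma>"
  obtains k where "k \<in> Ar C" "Dom C k = Dom C (PI P (sub C B \<sigma>))" "Cod C k = Dom C (sub C (PI P B) \<sigma>)"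
    "\<phi> B \<sigma> \<odot> k = Idt C (Dom C (PI P (sub C B \<sigma>)))" "k \<odot> \<phi> B \<sigma> = Idt C (Dom C (sub C (PI P B) \<sigma>))"
  using stability[OF assms] unfolding stability_iso_def iso_slice_iff hom_def by blast

lemma stability_rfl:
  assumes "B \<in> R" "\<sigma> \<in> Ar C" "Cod C B = Cod C \<sigma>"
  shows "rfl P (sub C B \<sigma>) = \<phi> B \<sigma> \<odot> sub_map C \<sigma> B (rfl P B) (PI P B)"
  using stability[OF assms] by (simp add: stability_iso_def)

lemma sub_map_arr [simp]:
  assumes "A \<in> Ar C" "B \<in> Ar C" "h \<in> Ar C" "\<sigma> \<in> Ar C" "Cod C A = Cod C \<sigma>" "Cod C B = Cod C \<sigma>"
    "Dom C h = Dom C A" "Cod C h = Dom C B" "B \<odot> h = A"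
  shows "sub_map C \<sigma> A h B \<in> Ar C" "Dom C (sub_map C \<sigma> A h B) = Dom C (sub C A \<sigma>)"
    "Cod C (sub_map C \<sigma> A h B) = Dom C (sub C B \<sigma>)"
    "sub C B \<sigma> \<odot> sub_map C \<sigma> A h B = sub C A \<sigma>"
    "proj C B \<sigma> \<odot> sub_map C \<sigma> A h B = h \<odot> proj C A \<sigma>"
proof -
  have "B \<odot> (h \<odot> proj C A \<sigma>) = \<sigma> \<odot> sub C A \<sigma>"
    using assms comp_reassoc[of B h A "proj C A \<sigma>"] by simp
  then show "sub_map C \<sigma> A h B \<in> Ar C" "Dom C (sub_map C \<sigma> A h B) = Dom C (sub C A \<sigma>)"
    "Cod C (sub_map C \<sigma> A h B) = Dom C (sub C B \<sigma>)"
    "sub C B \<sigma> \<odot> sub_map C \<sigma> A h B = sub C A \<sigma>"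
    "proj C B \<sigma> \<odot> sub_map C \<sigma> A h B = h \<odot> proj C A \<sigma>"
    using assms by (simp_all add: sub_map_def)
qed

lemma sub_map_comp [simp]:
  assumes "A \<in> Ar C" "B \<in> Ar C" "h \<in> Ar C" "\<sigma> \<in> Ar C" "Cod C A = Cod C \<sigma>" "Cod C B = Cod C \<sigma>"
    "Dom C h = Dom C A" "Cod C h = Dom C B" "B \<odot> h = A" "x \<in> Ar C" "Cod C x = Dom C (sub C A \<sigma>)"
  shows "sub C B \<sigma> \<odot> (sub_map C \<sigma> A h B \<odot> x) = sub C A \<sigma> \<odot> x"
    "proj C B \<sigma> \<odot> (sub_map C \<sigma> A h B \<odot> x) = h \<odot> (proj C A \<sigma> \<odot> x)"
  using assms comp_reassoc[of "sub C B \<sigma>" "sub_map C \<sigma> A h B" "sub C A \<sigma>" x]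
    comp_reassoc[of "proj C B \<sigma>" "sub_map C \<sigma> A h B" "h \<odot> proj C A \<sigma>" x] by simp_all

text \<open>Compatibility of \<open>\<phi> A \<sigma>\<close> with \<open>p\<close>, in coordinates.
  An arrow into the square of \<open>\<sigma>\<^sup>*A\<close> is known from its two components, and
  each component from its base and its image in \<open>A\<close>; the generalised element
  \<open>x\<close> makes the four equations usable inside longer composites.\<close>

lemma stability_ends:
  assumes A: "A \<in> R" "\<sigma> \<in> Ar C" "Cod C A = Cod C \<sigma>" and x: "x \<in> Ar C" "Cod C x = Dom C (sub C (PI P A) \<sigma>)"
  defines "A' \<equiv> sub C A \<sigma>"
  defines "e \<equiv> ends P A' \<odot> (\<phi> A \<sigma> \<odot> x)"
  shows "sub C A \<sigma> \<odot> (sub C A' A' \<odot> e) = sub C (PI P A) \<sigma> \<odot> x"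
    "proj C A \<sigma> \<odot> (sub C A' A' \<odot> e) = sub C A A \<odot> (ends P A \<odot> (proj C (PI P A) \<sigma> \<odot> x))"
    "sub C A \<sigma> \<odot> (proj C A' A' \<odot> e) = sub C (PI P A) \<sigma> \<odot> x"
    "proj C A \<sigma> \<odot> (proj C A' A' \<odot> e) = proj C A A \<odot> (ends P A \<odot> (proj C (PI P A) \<sigma> \<odot> x))"
proof -
  let ?m = "sub_map C \<sigma> (PI P A) (ends P A) (sq C A)"
  have "ends P A' \<odot> \<phi> A \<sigma> = sq_sub C A \<sigma> \<odot> ?m"
    using stability[OF A] by (simp add: stability_iso_def A'_def)
  \<comment> \<open>Both projections of the square are arrows over the base, so
    \<open>sub_map\<close> may be applied to them.\<close>
  moreover have [simp]: "A \<odot> sub C A A = sq C A" "A \<odot> proj C A A = sq C A"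
    using A by (simp_all add: sq_def)
  have [simp]: "sq_sub C A \<sigma> \<in> Ar C" "Dom C (sq_sub C A \<sigma>) = Dom C (sub C (sq C A) \<sigma>)"
    "Cod C (sq_sub C A \<sigma>) = Dom C (sub C A' A')"
    using A by (simp_all add: sq_sub_def A'_def)
  ultimately have e: "e = sq_sub C A \<sigma> \<odot> (?m \<odot> x)"
    unfolding e_def using A x comp_reassoc[of "ends P A'" "\<phi> A \<sigma>" "sq_sub C A \<sigma> \<odot> ?m" x]
    by (simp add: A'_def)
  show "sub C A \<sigma> \<odot> (sub C A' A' \<odot> e) = sub C (PI P A) \<sigma> \<odot> x"
    "proj C A \<sigma> \<odot> (sub C A' A' \<odot> e) = sub C A A \<odot> (ends P A \<odot> (proj C (PI P A) \<sigma> \<odot> x))"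
    "sub C A \<sigma> \<odot> (proj C A' A' \<odot> e) = sub C (PI P A) \<sigma> \<odot> x"
    "proj C A \<sigma> \<odot> (proj C A' A' \<odot> e) = proj C A A \<odot> (ends P A \<odot> (proj C (PI P A) \<sigma> \<odot> x))"
    unfolding e sq_sub_def A'_def using A x by simp_all
qed

text \<open>This is the condition under which \<open>w\<close> and \<open>v\<close> pair to an arrow
  into \<open>\<sigma>\<^sup>*(A\<^sup>I)\<close>. It holds because \<open>A\<^sup>I\<close> lies
  over the base through its endpoints.\<close>

lemma path_square:
  assumes A: "A \<in> R" "\<sigma> \<in> Ar C" "Cod C A = Cod C \<sigma>"
    and q: "q \<in> Ar C" "Dom C q = Dom C \<sigma>" "Cod C q = Dom C (sub C A A)" "sq C A \<odot> q = \<sigma>"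
    and pull: "is_pullback C q (ends P A) w v"
  shows "PI P A \<odot> v = \<sigma> \<odot> w"
proof -
  note wv = is_pullback_D[OF pull]
  have "PI P A \<odot> v = sq C A \<odot> (q \<odot> w)"
    using path_comp(2)[OF A(1) wv(5)] A wv by simp
  also have "\<dots> = \<sigma> \<odot> w"
    by (rule comp_reassoc[OF q(4)]) (use A q wv in simp_all)
  finally show ?thesis .
qed

text \<open>With \<open>q = (a, b) \<odot> \<sigma>\<close> this gives the Beck-Chevalley isomorphism for \<open>Id\<^sub>A(a, b)\<close>, with
  \<open>q\<close> the identity of \<open>A \<times>\<^sub>X A\<close> the one for \<open>Id\<^sub>A(x, y)\<close>.\<close>

lemma path_pullback:
  assumes A: "A \<in> R" "\<sigma> \<in> Ar C" "Cod C A = Cod C \<sigma>"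
    and q: "q \<in> Ar C" "Dom C q = Dom C \<sigma>" "Cod C q = Dom C (sub C A A)" "sq C A \<odot> q = \<sigma>"
    and pull: "is_pullback C q (ends P A) w v"
  defines "A' \<equiv> sub C A \<sigma>"
  defines "x \<equiv> pair C A \<sigma> (Idt C (Dom C \<sigma>)) (sub C A A \<odot> q)"
  defines "y \<equiv> pair C A \<sigma> (Idt C (Dom C \<sigma>)) (proj C A A \<odot> q)"
  shows "is_pullback C (pair C A' A' x y) (ends P A') w (\<phi> A \<sigma> \<odot> pair C (PI P A) \<sigma> w v)"
proof -
  note [simp] = A q
  have wv [simp]: "w \<in> Ar C" "v \<in> Ar C" "Dom C v = Dom C w" "Cod C w = Dom C \<sigma>"
    "Cod C v = Dom C (PI P A)" "ends P A \<odot> v = q \<odot> w"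
    using is_pullback_D[OF pull] by simp_all
  have q_comp [simp]: "sq C A \<odot> (q \<odot> z) = \<sigma> \<odot> z" if "z \<in> Ar C" "Cod C z = Dom C \<sigma>" for z
    using that comp_reassoc[of "sq C A" q \<sigma> z] by simp
  have [simp]: "A \<odot> (sub C A A \<odot> q) = \<sigma>" "A \<odot> (proj C A A \<odot> q) = \<sigma>"
    using q(4)[unfolded sq_def] by simp_all
  have A' [simp]: "A' \<in> R" "Cod C A' = Dom C \<sigma>" "A' = sub C A \<sigma>"
    by (simp_all add: A'_def)
  have xy [simp]: "x \<in> Ar C" "y \<in> Ar C" "Dom C x = Dom C \<sigma>" "Dom C y = Dom C \<sigma>"
    "Cod C x = Dom C (sub C A \<sigma>)" "Cod C y = Dom C (sub C A \<sigma>)"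
    "sub C A \<sigma> \<odot> x = Idt C (Dom C \<sigma>)" "sub C A \<sigma> \<odot> y = Idt C (Dom C \<sigma>)"
    "proj C A \<sigma> \<odot> x = sub C A A \<odot> q" "proj C A \<sigma> \<odot> y = proj C A A \<odot> q"
    by (simp_all add: x_def y_def)
  have xy_comp [simp]: "sub C A \<sigma> \<odot> (x \<odot> z) = z" "sub C A \<sigma> \<odot> (y \<odot> z) = z"
    "proj C A \<sigma> \<odot> (x \<odot> z) = sub C A A \<odot> (q \<odot> z)" "proj C A \<sigma> \<odot> (y \<odot> z) = proj C A A \<odot> (q \<odot> z)"
    if "z \<in> Ar C" "Cod C z = Dom C \<sigma>" for z
    using that by (simp_all add: x_def y_def)
  note [simp] = path_square[OF A q pull]
  let ?g = "pair C (PI P A) \<sigma> w v" and ?e = "pair C (sub C A \<sigma>) (sub C A \<sigma>) x y"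
  obtain \<psi> where \<psi>: "\<psi> \<in> Ar C" "Dom C \<psi> = Dom C (PI P (sub C A \<sigma>))"
    "Cod C \<psi> = Dom C (sub C (PI P A) \<sigma>)"
    "\<phi> A \<sigma> \<odot> \<psi> = Idt C (Dom C (PI P (sub C A \<sigma>)))" "\<psi> \<odot> \<phi> A \<sigma> = Idt C (Dom C (sub C (PI P A) \<sigma>))"
    by (rule stability_inverse[OF A])
  note E = stability_ends[OF A]
  show ?thesis
    unfolding A'(3)
  proof (rule is_pullbackI)
    show "ends P (sub C A \<sigma>) \<odot> (\<phi> A \<sigma> \<odot> ?g) = ?e \<odot> w"
    \<comment> \<open>Removing the projections of the square and then those of
      \<open>sub C A \<sigma>\<close> leaves the four coordinates computed in
      \<open>E\<close>.\<close>
    proof (rule pair_eqI[of "sub C A \<sigma>" "sub C A \<sigma>"])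
      show "sub C (sub C A \<sigma>) (sub C A \<sigma>) \<odot> (ends P (sub C A \<sigma>) \<odot> (\<phi> A \<sigma> \<odot> ?g))
          = sub C (sub C A \<sigma>) (sub C A \<sigma>) \<odot> (?e \<odot> w)"
        by (rule pair_eqI[of A \<sigma>]) (simp_all add: E)
      show "proj C (sub C A \<sigma>) (sub C A \<sigma>) \<odot> (ends P (sub C A \<sigma>) \<odot> (\<phi> A \<sigma> \<odot> ?g))
          = proj C (sub C A \<sigma>) (sub C A \<sigma>) \<odot> (?e \<odot> w)"
        by (rule pair_eqI[of A \<sigma>]) (simp_all add: E)
    qed simp_all
  next
    fix h k assume "h \<in> Ar C" "k \<in> Ar C" "Dom C k = Dom C h" "Cod C h = Dom C ?e"
      "Cod C k = Dom C (ends P (sub C A \<sigma>))" and eq: "ends P (sub C A \<sigma>) \<odot> k = ?e \<odot> h"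
    then have hk [simp]: "h \<in> Ar C" "k \<in> Ar C" "Dom C k = Dom C h" "Cod C h = Dom C \<sigma>"
      "Cod C k = Dom C (PI P (sub C A \<sigma>))"
      by simp_all
    \<comment> \<open>The inverse of \<open>\<phi> A \<sigma>\<close> carries \<open>k\<close> back
      to \<open>\<sigma>\<^sup>*(A\<^sup>I)\<close>. The image of \<open>k'\<close> in
      \<open>A\<^sup>I\<close> has endpoints \<open>q \<odot> h\<close>, so it forms with
      \<open>h\<close> a cone over the given pullback.\<close>
    define k' where "k' = \<psi> \<odot> k"
    have k' [simp]: "k' \<in> Ar C" "Dom C k' = Dom C h" "Cod C k' = Dom C (sub C (PI P A) \<sigma>)" "\<phi> A \<sigma> \<odot> k' = k"
      using \<psi> comp_reassoc[of "\<phi> A \<sigma>" \<psi> "Idt C (Dom C (PI P (sub C A \<sigma>)))" k] by (simp_all add: k'_def)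
    note Ek = E[OF k'(1,3), unfolded k'(4) eq]
    have k'1: "sub C (PI P A) \<sigma> \<odot> k' = h"
      using Ek(1) by simp
    have "ends P A \<odot> (proj C (PI P A) \<sigma> \<odot> k') = q \<odot> h"
      by (rule pair_eqI[of A A]) (use Ek(2,4) in simp_all)
    then have "\<exists>!l. l \<in> hom C (Dom C h) (Dom C w) \<and> w \<odot> l = h \<and> v \<odot> l = proj C (PI P A) \<sigma> \<odot> k'"
      by (intro is_pullback_universal[OF pull]) simp_all
    then obtain l where l: "l \<in> Ar C" "Dom C l = Dom C h" "Cod C l = Dom C w" "w \<odot> l = h"
        "v \<odot> l = proj C (PI P A) \<sigma> \<odot> k'"
      by (auto simp: hom_def)
    have "?g \<odot> l = k'"
      by (rule pair_eqI[of "PI P A" \<sigma>]) (use l k'1 in simp_all)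
    then show "\<exists>l \<in> Ar C. Dom C l = Dom C h \<and> Cod C l = Dom C w \<and> w \<odot> l = h \<and> (\<phi> A \<sigma> \<odot> ?g) \<odot> l = k"
      using l by (intro bexI[of _ l]) simp_all
  next
    fix l m assume lm [simp]: "l \<in> Ar C" "m \<in> Ar C" "Dom C l = Dom C m" "Cod C l = Dom C w" "Cod C m = Dom C w"
      and w: "w \<odot> l = w \<odot> m" and v: "(\<phi> A \<sigma> \<odot> ?g) \<odot> l = (\<phi> A \<sigma> \<odot> ?g) \<odot> m"
    \<comment> \<open>Cancelling \<open>\<phi> A \<sigma>\<close> and projecting to
      \<open>A\<^sup>I\<close> recovers \<open>v\<close>, so joint monicity of \<open>w\<close> and
      \<open>v\<close> applies.\<close>
    have "\<psi> \<odot> (\<phi> A \<sigma> \<odot> (?g \<odot> z)) = ?g \<odot> z" if z: "z \<in> Ar C" "Cod C z = Dom C w" for z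
    proof -
      have "\<psi> \<odot> (\<phi> A \<sigma> \<odot> (?g \<odot> z)) = Idt C (Dom C (sub C (PI P A) \<sigma>)) \<odot> (?g \<odot> z)"
        by (rule comp_reassoc[OF \<psi>(5)]) (use z \<psi>(1-3) in simp_all)
      then show ?thesis
        using z by simp
    qed
    moreover have v': "\<phi> A \<sigma> \<odot> (?g \<odot> l) = \<phi> A \<sigma> \<odot> (?g \<odot> m)"
      using v by simp
    ultimately have "?g \<odot> l = ?g \<odot> m"
      using lm by metis
    then have "proj C (PI P A) \<sigma> \<odot> (?g \<odot> l) = proj C (PI P A) \<sigma> \<odot> (?g \<odot> m)"
      by simp
    then have "v \<odot> l = v \<odot> m"
      by simp
    then show "l = m"
      by (rule is_pullback_eqI[OF pull lm w])
  qed simp_all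
qed


section \<open>Substitution\<close>

lemma iso_sub_comp:
  assumes A: "A \<in> R" "\<sigma> \<in> Ar C" "\<tau> \<in> Ar C" "Cod C A = Cod C \<sigma>" "Cod C \<tau> = Dom C \<sigma>"
  shows "iso (slice C (Dom C \<tau>)) (sub C (sub C A \<sigma>) \<tau>, sub_comp C A \<sigma> \<tau>, sub C A (\<sigma> \<odot> \<tau>))"
proof -
  have "iso (slice C (Dom C (\<sigma> \<odot> \<tau>))) (sub C (sub C A \<sigma>) \<tau>, sub_comp C A \<sigma> \<tau>, sub C A (\<sigma> \<odot> \<tau>))"
    unfolding sub_comp_def by (intro iso_slice_pullback pullback_paste) (use A in simp_all)
  then show ?thesis using A by simp
qed

text \<open>Here the prescribed arrow leaves the chosen pullback, so the comparison pairing
  \<open>?k\<close> appears as its inverse.\<close>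

lemma iso_sub_idt:
  assumes "A \<in> R"
  shows "iso (slice C (Cod C A)) (sub C A (Idt C (Cod C A)), sub_idt C A, A)"
proof -
  let ?i = "Idt C (Cod C A)" and ?k = "pair C A (Idt C (Cod C A)) A (Idt C (Dom C A))"
  have "proj C A ?i \<odot> ?k = Idt C (Dom C A)" "A \<odot> proj C A ?i = sub C A ?i"
    using assms by simp_all
  moreover have "?k \<odot> proj C A ?i = Idt C (Dom C (sub C A ?i))"
    by (rule pair_eqI[of A ?i]) (use assms in simp_all)
  ultimately show ?thesis
    using assms by (auto simp: iso_slice_iff sub_idt_def hom_def intro!: exI[of _ ?k])
qed

lemma tm_comp:
  assumes "a \<in> tm C A" "A \<in> R" "x \<in> Ar C" "Cod C x = Cod C A"
  shows "A \<odot> (a \<odot> x) = x"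
  using tm_D[OF assms(1)] assms comp_reassoc[OF tm_D(4)[OF assms(1)], of x] by simp

lemma tm_sub_arr:
  assumes "a \<in> tm C A" "A \<in> R" "\<sigma> \<in> Ar C" "Cod C A = Cod C \<sigma>"
  shows "tm_sub C A \<sigma> a \<in> Ar C" "Dom C (tm_sub C A \<sigma> a) = Dom C \<sigma>"
    "Cod C (tm_sub C A \<sigma> a) = Dom C (sub C A \<sigma>)"
    "sub C A \<sigma> \<odot> tm_sub C A \<sigma> a = Idt C (Dom C \<sigma>)" "proj C A \<sigma> \<odot> tm_sub C A \<sigma> a = a \<odot> \<sigma>"
    "\<And>x. x \<in> Ar C \<Longrightarrow> Cod C x = Dom C \<sigma> \<Longrightarrow> sub C A \<sigma> \<odot> (tm_sub C A \<sigma> a \<odot> x) = x"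
    "\<And>x. x \<in> Ar C \<Longrightarrow> Cod C x = Dom C \<sigma> \<Longrightarrow> proj C A \<sigma> \<odot> (tm_sub C A \<sigma> a \<odot> x) = a \<odot> (\<sigma> \<odot> x)"
  using tm_D[OF assms(1)] tm_comp[OF assms(1,2)] assms by (simp_all add: tm_sub_def)

text \<open>A normal form for terms substituted twice. The term \<open>a\<close> may be any section
  of the pulled-back type, because the last variable and the datum \<open>d\<close> of the
  conversion rule need not come from a term of the original type.\<close>

lemma sub_comp_tm_sub:
  assumes A: "A \<in> R" "\<sigma> \<in> Ar C" "\<tau> \<in> Ar C" "Cod C A = Cod C \<sigma>" "Cod C \<tau> = Dom C \<sigma>"
    and a: "a \<in> tm C (sub C A \<sigma>)"
  shows "sub_comp C A \<sigma> \<tau> \<odot> tm_sub C (sub C A \<sigma>) \<tau> a = pair C A (\<sigma> \<odot> \<tau>) (Idt C (Dom C \<tau>)) (proj C A \<sigma> \<odot> (a \<odot> \<tau>))"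
proof -
  note t = tm_sub_arr[OF a, of \<tau>]
  have "\<sigma> \<odot> \<tau> = A \<odot> (proj C A \<sigma> \<odot> (a \<odot> \<tau>))"
    using A tm_D[OF a] tm_comp[OF a, of \<tau>] by simp
  note [simp] = this[symmetric]
  show ?thesis
    by (rule pair_eqI[of A "\<sigma> \<odot> \<tau>"]) (use A t tm_D[OF a] in \<open>simp_all add: sub_comp_def\<close>)
qed

lemma diag_arr [simp]:
  assumes "A \<in> R"
  shows "diag C A \<in> Ar C" "Dom C (diag C A) = Dom C A" "Cod C (diag C A) = Dom C (sub C A A)"
    "sub C A A \<odot> diag C A = Idt C (Dom C A)" "proj C A A \<odot> diag C A = Idt C (Dom C A)"
    "\<And>x. x \<in> Ar C \<Longrightarrow> Cod C x = Dom C A \<Longrightarrow> sub C A A \<odot> (diag C A \<odot> x) = x"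
    "\<And>x. x \<in> Ar C \<Longrightarrow> Cod C x = Dom C A \<Longrightarrow> proj C A A \<odot> (diag C A \<odot> x) = x"
  using assms by (simp_all add: diag_def)

lemma last_var_tm: "A \<in> R \<Longrightarrow> last_var C A \<in> tm C (sub C A A)"
  by (simp add: last_var_def tm_def hom_def)

lemma substitution_equations: "substitution_equations C R"
  unfolding substitution_equations_def
proof (intro allI impI ballI conjI)
  fix \<Gamma> A assume "A \<in> ty C R \<Gamma>"
  then have A: "A \<in> R" "Cod C A = ob C \<Gamma>"
    by (simp_all add: ty_def)
  {
    fix \<sigma> \<tau> assume "\<sigma> \<in> Ar C \<and> \<tau> \<in> Ar C \<and> Cod C \<sigma> = ob C \<Gamma> \<and> Cod C \<tau> = Dom C \<sigma>"
    with A have s: "\<sigma> \<in> Ar C" "\<tau> \<in> Ar C" "Cod C A = Cod C \<sigma>" "Cod C \<tau> = Dom C \<sigma>"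
      by simp_all
    show "iso (slice C (Dom C \<tau>)) (sub C (sub C A \<sigma>) \<tau>, sub_comp C A \<sigma> \<tau>, sub C A (\<sigma> \<odot> \<tau>))"
      using iso_sub_comp A s by simp
    fix a assume a: "a \<in> tm C A"
    show "sub_comp C A \<sigma> \<tau> \<odot> tm_sub C (sub C A \<sigma>) \<tau> (tm_sub C A \<sigma> a) = tm_sub C A (\<sigma> \<odot> \<tau>) a"
      using sub_comp_tm_sub[OF A(1) s tm_sub_tm] A s a tm_sub_arr[OF a A(1) s(1,3)] tm_D[OF a]
      by (simp add: tm_sub_def[of C A "\<sigma> \<odot> \<tau>"])
  next
    show "iso (slice C (ob C \<Gamma>)) (sub C A (Idt C (ob C \<Gamma>)), sub_idt C A, A)"
      using iso_sub_idt[OF A(1)] A by simp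
  next
    fix a assume a: "a \<in> tm C A"
    show "sub_idt C A \<odot> tm_sub C A (Idt C (ob C \<Gamma>)) a = a"
      using A tm_D[OF a] tm_sub_arr(5)[OF a, of "Idt C (ob C \<Gamma>)"] Cod_Ob[of A] by (simp add: sub_idt_def)
  next
    fix c assume c: "c \<in> tm C A"
    have l: "last_var C A \<in> tm C (sub C A A)"
      using A by (simp add: last_var_tm)
    have "Cod C A \<in> Ob C"
      using A(1) by simp
    \<comment> \<open>Since \<open>A \<odot> c\<close> is an identity, the normal form lies in the
      pullback along it, and \<open>sub_idt\<close> reads off its second component: the diagonal at
      \<open>c\<close>, projected to \<open>c\<close>.\<close>
    then show "sub_idt C A \<odot> (sub_comp C A A c \<odot> tm_sub C (sub C A A) c (last_var C A)) = c"
      using sub_comp_tm_sub[OF A(1) _ _ _ _ l, of c] A(1) tm_D[OF c]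
      by (simp add: sub_idt_def last_var_def)
  }
qed

section \<open>Contexts and substitution in telescopes\<close>

lemma ctx_Cons: "ctx C R (A # \<Gamma>) \<longleftrightarrow> ctx C R \<Gamma> \<and> A \<in> ty C R \<Gamma>"
  by (auto simp: ctx_def ty_def ob_def)

lemma ob_Cons [simp]: "ob C (A # \<Gamma>) = Dom C A"
  by (simp add: ob_def)

lemma ctx_append: "ctx C R (\<Theta> @ \<Gamma>) \<Longrightarrow> ctx C R \<Gamma>"
  by (induction \<Theta>) (simp_all add: ctx_Cons)

text \<open>Weakening is the case where \<sigma> is a fibration \<open>A\<close>, substitution the
  case where it is a section. At each entry of the telescope, the second pullback projection is the
  arrow along which the next entry is pulled back.\<close>

lemma tele_sub_ctx:
  assumes "ctx C R \<Delta>" "\<sigma> \<in> hom C (ob C \<Delta>) (ob C \<Gamma>)" "ctx C R (\<Theta> @ \<Gamma>)"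
  shows "ctx C R (tele_sub C \<sigma> \<Theta> @ \<Delta>) \<and> lift C \<sigma> \<Theta> \<in> hom C (ob C (tele_sub C \<sigma> \<Theta> @ \<Delta>)) (ob C (\<Theta> @ \<Gamma>))"
  using assms(3)
proof (induction \<Theta>)
  case Nil
  then show ?case using assms by simp
next
  case (Cons A \<Theta>)
  then show ?case by (simp add: ctx_Cons ty_def hom_def)
qed

lemma acts_on_judgements:
  assumes "ctx C R \<Delta>" "w \<in> hom C (ob C \<Delta>) (ob C \<Gamma>)"
  shows "acts_on_judgements C R \<Delta> w \<Gamma>"
  using assms tm_sub_tm by (simp add: acts_on_judgements_def ty_def hom_def)

lemma context_rules: "context_rules C R"
proof -
  have "ctx C R []" "ob C [] = unit_ob C"
    by (simp_all add: ctx_def ob_def)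
  then show ?thesis
    using terminal_unit_ob last_var_tm by (simp add: context_rules_def ctx_Cons ty_def)
qed

lemma lift_weakening:
  assumes "ctx C R (\<Theta> @ \<Gamma>)" "A \<in> ty C R \<Gamma>"
  shows "ctx C R (tele_sub C A \<Theta> @ A # \<Gamma>) \<and>
    lift C A \<Theta> \<in> hom C (ob C (tele_sub C A \<Theta> @ A # \<Gamma>)) (ob C (\<Theta> @ \<Gamma>))"
  by (rule tele_sub_ctx) (use assms ctx_append in \<open>auto simp: ctx_Cons ty_def hom_def\<close>)

lemma lift_substitution:
  assumes "ctx C R (\<Theta> @ A # \<Gamma>)" "c \<in> tm C A"
  shows "ctx C R (tele_sub C c \<Theta> @ \<Gamma>) \<and>
    lift C c \<Theta> \<in> hom C (ob C (tele_sub C c \<Theta> @ \<Gamma>)) (ob C (\<Theta> @ A # \<Gamma>))"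
  by (rule tele_sub_ctx)
    (use assms(2) ctx_append[OF assms(1)] assms(1) in \<open>auto simp: ctx_Cons ty_def tm_def hom_def\<close>)

lemma weakening_rule: "weakening_rule C R"
  unfolding weakening_rule_def using lift_weakening acts_on_judgements by blast

lemma substitution_rule: "substitution_rule C R"
  unfolding substitution_rule_def using lift_substitution acts_on_judgements by blast


section \<open>Identity types\<close>

lemma term_pair [simp]:
  assumes "A \<in> R" "a \<in> Ar C" "b \<in> Ar C" "Dom C b = Dom C a" "Cod C a = Dom C A" "Cod C b = Dom C A"
    "A \<odot> a = A \<odot> b"
  shows "sq C A \<odot> pair C A A a b = A \<odot> a"
  using assms by (simp add: sq_def)

lemma Id_formation: "Id_formation C R P"
  by (simp add: Id_formation_def ty_def Id_ty_def tm_def hom_def)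

text \<open>As \<open>p \<odot> r\<close> is the diagonal, \<open>r \<odot> a\<close> lies over
  \<open>(a, a)\<close>; this is what makes the pairing in \<open>rfl_tm\<close> well
  defined.\<close>

lemma rfl_pair:
  assumes "A \<in> R" "a \<in> Ar C" "Cod C a = Dom C A"
  shows "pair C A A a a = ends P A \<odot> (rfl P A \<odot> a)"
  by (rule pair_eqI[of A A]) (use assms in simp_all)

lemma rfl_tm_arr:
  assumes A: "A \<in> R" "a \<in> tm C A"
  shows "rfl_tm C P A a \<in> tm C (Id_ty C P A a a)"
    "proj C (ends P A) (pair C A A a a) \<odot> rfl_tm C P A a = rfl P A \<odot> a"
proof -
  note [simp] = tm_D[OF A(2)]
  have [simp]: "pair C A A a a \<in> Ar C" "Dom C (pair C A A a a) = Cod C A"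
    "Cod C (pair C A A a a) = Dom C (sub C A A)"
    using A by simp_all
  have "diag C A \<odot> a = pair C A A a a"
    using rfl_pair[of A a] A by simp
  then show "rfl_tm C P A a \<in> tm C (Id_ty C P A a a)"
    "proj C (ends P A) (pair C A A a a) \<odot> rfl_tm C P A a = rfl P A \<odot> a"
    using A(1) by (simp_all add: rfl_tm_def tm_def Id_ty_def hom_def)
qed

lemma Id_introduction: "Id_introduction C R P"
  using rfl_tm_arr by (simp add: Id_introduction_def ty_def)

lemma Id_el_rfl:
  assumes "A \<in> R" "a \<in> tm C A"
  shows "Id_el C P A a a (rfl_tm C P A a) = rfl P A \<odot> a"
  using rfl_tm_arr(2)[OF assms] by (simp add: Id_el_def)

section \<open>Elimination and conversion\<close>

lemma J_exists:
  assumes "A \<in> R" "D \<in> R" "Cod C D = Dom C (PI P A)" "d \<in> tm C (sub C D (rfl P A))"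
  shows "\<exists>l. l \<in> tm C D \<and> l \<odot> rfl P A = proj C D (rfl P A) \<odot> d"
proof -
  note d = tm_D[OF assms(4)]
  have "PI P A \<in> Ar C" using assms by simp
  \<comment> \<open>The lower edge of the lifting square is the identity of
    \<open>A\<^sup>I\<close>, so the lower triangle makes the lift a section of \<open>D\<close>, as
    elimination needs; the upper triangle is conversion. The square commutes because
    \<open>d\<close> is a section of the pullback of \<open>D\<close> along
    \<open>r\<close>.\<close>
  then have "\<exists>l \<in> hom C (Cod C (rfl P A)) (Dom C D). D \<odot> l = Idt C (Cod C D) \<and>
      l \<odot> rfl P A = proj C D (rfl P A) \<odot> d"
    by (intro lifting) (use assms(1-3) d in simp_all)
  then show ?thesis
    using assms by (auto simp: tm_def)
qed

lemma Id_el_arr: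
  assumes "A \<in> R" "a \<in> tm C A" "b \<in> tm C A" "q \<in> tm C (Id_ty C P A a b)"
  shows "Id_el C P A a b q \<in> Ar C" "Dom C (Id_el C P A a b q) = Cod C A"
    "Cod C (Id_el C P A a b q) = Dom C (PI P A)"
  using assms(1) tm_D[OF assms(2)] tm_D[OF assms(3)] tm_D[OF assms(4)]
  by (simp_all add: Id_el_def Id_ty_def)

text \<open>The two rules are proved together because they must hold for the same choice of
  lifts.\<close>

lemma Id_elimination_conversion: "\<exists>J. Id_elimination C R P J \<and> Id_conversion C R P J"
proof -
  define J where "J = (\<lambda>A D d. SOME l. l \<in> tm C D \<and> l \<odot> rfl P A = proj C D (rfl P A) \<odot> d)"
  have J: "J A D d \<in> tm C D" "J A D d \<odot> rfl P A = proj C D (rfl P A) \<odot> d"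
    if "A \<in> R" "D \<in> R" "Cod C D = Dom C (PI P A)" "d \<in> tm C (sub C D (rfl P A))" for A D d
    using someI_ex[OF J_exists[OF that]] by (simp_all add: J_def)
  have "Id_elimination C R P J"
    unfolding Id_elimination_def
  proof (intro allI impI ballI conjI)
    fix \<Gamma> A D d assume "A \<in> ty C R \<Gamma>" "D \<in> ty C R (ctx_Id C P \<Gamma> A)" and d: "d \<in> tm C (sub C D (rfl P A))"
    then have D: "A \<in> R" "D \<in> R" "Cod C D = Dom C (PI P A)"
      by (simp_all add: ty_def ctx_Id_def)
    show "J A D d \<in> tm C D"
      using J D d by blast
    then show "J_tm C P J A D d a b q \<in> tm C (sub C D (Id_el C P A a b q))"
      if "a \<in> tm C A" "b \<in> tm C A" "q \<in> tm C (Id_ty C P A a b)" for a b q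
      unfolding J_tm_def by (intro tm_sub_tm) (use D Id_el_arr[OF D(1) that] in simp_all)
  qed
  moreover have "Id_conversion C R P J"
    unfolding Id_conversion_def
  proof (intro allI impI ballI conjI)
    fix \<Gamma> A D d assume "A \<in> ty C R \<Gamma>" "D \<in> ty C R (ctx_Id C P \<Gamma> A)" and d: "d \<in> tm C (sub C D (rfl P A))"
    then have D: "A \<in> R" "D \<in> R" "Cod C D = Dom C (PI P A)"
      by (simp_all add: ty_def ctx_Id_def)
    note j = J[OF D d]
    show "J A D d \<odot> rfl P A = proj C D (rfl P A) \<odot> d"
      by (rule j)
    fix a assume a: "a \<in> tm C A"
    \<comment> \<open>The reflexivity term names the element \<open>r \<odot> a\<close> of
      \<open>A\<^sup>I\<close>, so conversion at \<open>a\<close> is the upper triangle composed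
      with \<open>a\<close>; both sides of the rule then have the same pairing as normal
      form.\<close>
    have "J A D d \<odot> (rfl P A \<odot> a) = proj C D (rfl P A) \<odot> (d \<odot> a)"
      using D tm_D[OF a] tm_D[OF d] tm_D[OF j(1)] comp_reassoc[OF j(2), of a] by simp
    then show "J_tm C P J A D d a a (rfl_tm C P A a)
        = sub_comp C D (rfl P A) a \<odot> tm_sub C (sub C D (rfl P A)) a d"
      using D tm_D[OF a] sub_comp_tm_sub[OF D(2) _ _ _ _ d, of a]
      by (simp add: J_tm_def tm_sub_def Id_el_rfl[OF D(1) a])
  qed
  ultimately show ?thesis by blast
qed

section \<open>Beck-Chevalley for identity types and reflexivity terms\<close>

lemma Id_pullback:
  assumes A: "A \<in> R" "\<sigma> \<in> Ar C" "Cod C A = Cod C \<sigma>" "a \<in> tm C A" "b \<in> tm C A"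
  defines "w \<equiv> sub C (Id_ty C P A a b) \<sigma>"
  defines "v \<equiv> proj C (ends P A) (pair C A A a b) \<odot> proj C (Id_ty C P A a b) \<sigma>"
  shows "PI P A \<odot> v = \<sigma> \<odot> w"
    "is_pullback C (pair C (sub C A \<sigma>) (sub C A \<sigma>) (tm_sub C A \<sigma> a) (tm_sub C A \<sigma> b))
      (ends P (sub C A \<sigma>)) w (\<phi> A \<sigma> \<odot> pair C (PI P A) \<sigma> w v)"
proof -
  note [simp] = A(1-3) tm_D(1-3)[OF A(4)] tm_D(1-3)[OF A(5)]
  have [simp]: "A \<odot> a = Idt C (Cod C \<sigma>)" "A \<odot> b = Idt C (Cod C \<sigma>)"
    using tm_D(4)[OF A(4)] tm_D(4)[OF A(5)] by simp_all
  let ?q = "pair C A A a b"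
  \<comment> \<open>The identity type is itself a pullback of \<open>p\<close>, so substituting in
    it pastes two chosen squares.\<close>
  have pull: "is_pullback C (?q \<odot> \<sigma>) (ends P A) w v"
    unfolding w_def v_def Id_ty_def by (rule pullback_paste) simp_all
  have "sq C A \<odot> (?q \<odot> \<sigma>) = Idt C (Cod C \<sigma>) \<odot> \<sigma>"
    by (rule comp_reassoc) simp_all
  then have sq: "sq C A \<odot> (?q \<odot> \<sigma>) = \<sigma>" by simp
  show "PI P A \<odot> v = \<sigma> \<odot> w"
    by (rule path_square[OF A(1-3) _ _ _ sq pull]) simp_all
  show "is_pullback C (pair C (sub C A \<sigma>) (sub C A \<sigma>) (tm_sub C A \<sigma> a) (tm_sub C A \<sigma> b))
      (ends P (sub C A \<sigma>)) w (\<phi> A \<sigma> \<odot> pair C (PI P A) \<sigma> w v)"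
    using path_pullback[OF A(1-3) _ _ _ sq pull] by (simp add: tm_sub_def)
qed

lemma Id_commutes:
  assumes A: "A \<in> R" "\<sigma> \<in> Ar C" "Cod C A = Cod C \<sigma>" "a \<in> tm C A" "b \<in> tm C A"
  shows "Id_commutes C P \<phi> A a b \<sigma>"
  using iso_slice_pullback[OF _ _ _ Id_pullback(2)[OF A]] A
    tm_sub_arr[OF A(4,1,2,3)] tm_sub_arr[OF A(5,1,2,3)]
  by (simp add: Id_commutes_def Id_sub_def Id_ty_def[of C P "sub C A \<sigma>"])

text \<open>The two sections are compared on the projections of the target identity type. The base
  coordinates are identities; the path coordinates agree because \<open>\<phi> A \<sigma>\<close>
  respects \<open>r\<close>.\<close>

lemma rfl_commutes:
  assumes A: "A \<in> R" "\<sigma> \<in> Ar C" "Cod C A = Cod C \<sigma>" "a \<in> tm C A"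
  shows "rfl_commutes C P \<phi> A a \<sigma>"
proof -
  let ?A = "sub C A \<sigma>" and ?a = "tm_sub C A \<sigma> a" and ?q = "pair C A A a a"
  let ?q' = "pair C ?A ?A ?a ?a"
  define I where "I = Id_ty C P A a a"
  define r where "r = rfl_tm C P A a"
  define w where "w = sub C I \<sigma>"
  define v where "v = proj C (ends P A) ?q \<odot> proj C I \<sigma>"
  define t where "t = tm_sub C I \<sigma> r"
  define g where "g = pair C (PI P A) \<sigma> w v"
  define S where "S = Id_sub C P \<phi> A a a \<sigma>"
  note [simp] = A(1-3) tm_D(1-3)[OF A(4)] tm_sub_arr(1-5)[OF A(4,1,2,3)]
  have a': "?a \<in> tm C ?A"
    using A by (intro tm_sub_tm) simp_all
  have r: "r \<in> tm C I" "proj C (ends P A) ?q \<odot> r = rfl P A \<odot> a"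
    using rfl_tm_arr A(1,4) by (simp_all add: r_def I_def)
  have r': "rfl_tm C P ?A ?a \<in> tm C (sub C (ends P ?A) ?q')"
    "proj C (ends P ?A) ?q' \<odot> rfl_tm C P ?A ?a = rfl P ?A \<odot> ?a"
    using rfl_tm_arr[OF _ a'] by (simp_all add: Id_ty_def)
  have I [simp]: "I \<in> R" "Cod C I = Cod C \<sigma>" "Dom C I = Dom C (proj C (ends P A) ?q)"
    by (simp_all add: I_def Id_ty_def)
  note [simp] = tm_D(1-3)[OF r(1)] tm_D(1-3)[OF r'(1)]
  have sq [simp]: "PI P A \<odot> v = \<sigma> \<odot> w"
    and pull: "is_pullback C ?q' (ends P ?A) w (\<phi> A \<sigma> \<odot> g)"
    using Id_pullback[OF A A(4)] by (simp_all add: I_def w_def v_def g_def)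
  have w [simp]: "w \<in> Ar C" "Cod C w = Dom C \<sigma>"
    by (simp_all add: w_def)
  have v [simp]: "v \<in> Ar C" "Dom C v = Dom C w" "Cod C v = Dom C (PI P A)"
    by (simp_all add: w_def v_def)
  have t [simp]: "t \<in> Ar C" "Dom C t = Dom C \<sigma>" "Cod C t = Dom C w" "w \<odot> t = Idt C (Dom C \<sigma>)"
    using tm_sub_arr[OF r(1)] by (simp_all add: t_def w_def)
  have "v \<odot> t = proj C (ends P A) ?q \<odot> (r \<odot> \<sigma>)"
    using tm_sub_arr[OF r(1)] by (simp add: v_def t_def)
  also have "\<dots> = (rfl P A \<odot> a) \<odot> \<sigma>"
    by (rule comp_reassoc[OF r(2)]) simp_all
  finally have vt [simp]: "v \<odot> t = rfl P A \<odot> (a \<odot> \<sigma>)"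
    by simp
  have g [simp]: "g \<in> Ar C" "Dom C g = Dom C w" "Cod C g = Dom C (sub C (PI P A) \<sigma>)"
    by (simp_all add: g_def)
  \<comment> \<open>Before \<open>\<phi> A \<sigma>\<close> is applied, the path coordinate is the
    pullback of \<open>r\<close> evaluated at the substituted term, the form to which
    \<open>stability_rfl\<close> applies.\<close>
  have gt: "g \<odot> t = sub_map C \<sigma> A (rfl P A) (PI P A) \<odot> ?a"
    by (rule pair_eqI[of "PI P A" \<sigma>]) (simp_all add: g_def)
  have S: "S = pair C (ends P ?A) ?q' w (\<phi> A \<sigma> \<odot> g)"
    by (simp add: S_def Id_sub_def w_def g_def I_def v_def)
  have sq' [simp]: "ends P ?A \<odot> (\<phi> A \<sigma> \<odot> g) = ?q' \<odot> w"
    using is_pullback_D(9)[OF pull] .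
  have "S \<odot> t = rfl_tm C P ?A ?a"
  proof (rule pair_eqI[of "ends P ?A" ?q'])
    show "sub C (ends P ?A) ?q' \<odot> (S \<odot> t) = sub C (ends P ?A) ?q' \<odot> rfl_tm C P ?A ?a"
      using tm_D(4)[OF r'(1)] by (simp add: S)
    show "proj C (ends P ?A) ?q' \<odot> (S \<odot> t) = proj C (ends P ?A) ?q' \<odot> rfl_tm C P ?A ?a"
      using r'(2) gt by (simp add: S stability_rfl)
  qed (simp_all add: S)
  then show ?thesis
    by (simp add: rfl_commutes_def S_def t_def I_def r_def)
qed

lemma Id_variables: "Id_variables C R P \<phi>"
  unfolding Id_variables_def Let_def
proof (intro allI impI ballI conjI)
  fix \<Gamma> A assume "A \<in> ty C R \<Gamma>"
  then have A [simp]: "A \<in> R"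
    by (simp add: ty_def)
  let ?\<pi> = "sq C A" and ?i = "Idt C (Dom C (sub C A A))"
  let ?A = "sub C A ?\<pi>" and ?x = "pair C A ?\<pi> ?i (sub C A A)" and ?y = "pair C A ?\<pi> ?i (proj C A A)"
  have Ob: "Dom C (sub C A A) \<in> Ob C"
    by simp
  \<comment> \<open>Reading the type as \<open>p\<close> itself amounts to pulling \<open>p\<close>
    back along the identity of the square.\<close>
  have pull: "is_pullback C ?i (ends P A) (ends P A) (Idt C (Dom C (ends P A)))"
    by (rule pullback_idt) simp_all
  have "is_pullback C (pair C ?A ?A ?x ?y) (ends P ?A) (ends P A)
      (\<phi> A ?\<pi> \<odot> pair C (PI P A) ?\<pi> (ends P A) (Idt C (Dom C (ends P A))))"
    using path_pullback[OF A _ _ _ _ _ _ pull, of ?\<pi>] Ob by simp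
  from iso_slice_pullback[OF _ _ _ this]
  show "iso (slice C (Dom C (sub C A A))) (ends P A,
      pair C (ends P ?A) (pair C ?A ?A ?x ?y) (ends P A)
        (\<phi> A ?\<pi> \<odot> pair C (PI P A) ?\<pi> (ends P A) (Idt C (Dom C (ends P A)))), Id_ty C P ?A ?x ?y)"
    using Ob by (simp add: Id_ty_def sq_def)
  \<comment> \<open>The last variable is the diagonal, so the left side is the reflexivity of the
    weakened type at that variable. After stability, the diagonal undoes the weakening in the
    pulled-back \<open>r\<close>.\<close>
  have "rfl P (sub C A A) \<odot> diag C A = \<phi> A A \<odot> (sub_map C A A (rfl P A) (PI P A) \<odot> diag C A)"
    by (simp add: stability_rfl)
  also have "sub_map C A A (rfl P A) (PI P A) \<odot> diag C A = pair C (PI P A) A (Idt C (Dom C A)) (rfl P A)"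
    by (rule pair_eqI[of "PI P A" A]) simp_all
  finally show "Id_el C P (sub C A A) (last_var C A) (last_var C A) (rfl_tm C P (sub C A A) (last_var C A))
      = \<phi> A A \<odot> pair C (PI P A) A (Idt C (Dom C A)) (rfl P A)"
    using Id_el_rfl[OF sub_R last_var_tm, of A] by (simp add: last_var_def)
qed

lemma models_identity_types: "\<exists>J. models_identity_types C R P \<phi> J"
proof -
  have sub: "A \<in> R \<and> lift C c \<Theta> \<in> Ar C \<and> Cod C A = Cod C (lift C c \<Theta>)"
    if "ctx C R (\<Theta> @ X # \<Gamma>)" "c \<in> tm C X" "A \<in> ty C R (\<Theta> @ X # \<Gamma>)" for \<Theta> X \<Gamma> c A
    using lift_substitution[OF that(1,2)] that(3) by (simp add: ty_def hom_def)
  have weak: "A \<in> R \<and> lift C X \<Theta> \<in> Ar C \<and> Cod C A = Cod C (lift C X \<Theta>)"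
    if "ctx C R (\<Theta> @ \<Gamma>)" "X \<in> ty C R \<Gamma>" "A \<in> ty C R (\<Theta> @ \<Gamma>)" for \<Theta> X \<Gamma> A
    using lift_weakening[OF that(1,2)] that(3) by (simp add: ty_def hom_def)
  have "Beck_Chevalley_Id C R P \<phi>"
    unfolding Beck_Chevalley_Id_def by (intro allI impI ballI Id_commutes) (use sub in blast)+
  moreover have "Beck_Chevalley_rfl C R P \<phi>"
    unfolding Beck_Chevalley_rfl_def by (intro allI impI ballI rfl_commutes) (use sub in blast)+
  moreover have "weakening_Id C R P \<phi>"
    unfolding weakening_Id_def
    by (intro allI impI ballI conjI Id_commutes rfl_commutes) (use weak in blast)+
  moreover obtain J where "Id_elimination C R P J" "Id_conversion C R P J"
    using Id_elimination_conversion by blast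
  ultimately have "models_identity_types C R P \<phi> J"
    unfolding models_identity_types_def
    using context_rules weakening_rule substitution_rule substitution_equations
      Id_formation Id_introduction Id_variables by (intro conjI)
  then show ?thesis by blast
qed

end

theorem theorem3p1:
  fixes C :: "('o, 'a) cat"
    and L R :: "'a set"
    and P :: "'a path_choice"
    and \<phi> :: "'a \<Rightarrow> 'a \<Rightarrow> 'a"
  assumes "category C"
    and "finitely_complete C"
    and "weak_factorization_system C L R"
    and "functorial_path_objects C L R P"
    and "stable_under_substitution C R P \<phi>"
  shows "\<exists>J. models_identity_types C R P \<phi> J"
proof -
  interpret category C by fact
  interpret stable_path_category C L R P \<phi>
    by unfold_locales fact+
  show ?thesis by (rule models_identity_types)
qed

end
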